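(* Suppose the following. (i) $\mathcal{L}\subset\mathbb{R}^N$ is a lattice of rank $r\le N$. (ii) $V\subseteq\mathbb{R}^N$ is the $r$-dimensional linear subspace spanned by $\mathcal{L}$. (iii) $W=V+w$ for some $w\in\mathbb{R}^N$. (iv) $K\subset\mathbb{R}^N$ is a compact convex set with non-empty interior $K^\circ$. (v) $\phi:K\to\mathbb{R}$ is continuous and the restriction of $\phi$ to $K\cap W$ has a unique maximum at some point $x_0\in K^\circ\cap W$. (vi) $\phi$ is twice continuously differentiable in a neighbourhood of $x_0$, and $H:=D^2\phi(x_0)$ is its Hessian at $x_0$. (vii) $\psi:K_1\to\mathbb{R}$ is a continuous function on some neighbourhood $K_1\subseteq K$ of $x_0$ with $\psi(x_0)>0$. (viii) For each positive integer $n$ there is a vector $\ell_n\in\mathbb{R}^N$ with $\ell_n/n\in W$. (ix) For each positive integer $n$ there are a real number $b_n>0$ and a function $a_n:(\mathcal{L}+\ell_n)\cap nK\to\mathbb{R}$ such that, as $n\to\infty$, $a_n(\ell)=O\big(b_n e^{n\phi(\ell/n)+o(n)}\big)$ uniformly for $\ell\in(\mathcal{L}+\ell_n)\cap nK$, and $a_n(\ell)=b_n\big(\psi(\ell/n)+o(1)\big)e^{n\phi(\ell/n)}$ uniformly for $\ell\in(\mathcal{L}+\ell_n)\cap nK_1$. Then, provided $\det(-H|_V)\neq 0$, as $n\to\infty$, \[\sum_{\ell\in(\mathcal{L}+\ell_n)\cap nK}a_n(\ell)\sim\frac{(2\pi)^{r/2}\psi(x_0)}{\mathrm{Vol}(\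mathcal{L})\,\det(-H|_V)^{1/2}}\,b_n\,n^{r/2}e^{n\phi(x_0)}.\]
   Context: A lattice is a discrete subgroup of $\mathbb{R}^N$; it has a basis $x_1,\dots,x_r$ (linearly independent, every element uniquely an integer combination), and $r$ is its rank. $\mathrm{Vol}(\mathcal{L})$ (the determinant or covolume) is the $r$-dimensional volume of a unit cell $\{\sum_i t_ix_i:0\le t_i<1\}$; equivalently $\mathrm{Vol}(\mathcal{L})^2=\det(\langle x_i,x_j\rangle)_{i,j=1}^r$ for any basis. For a bilinear form $B$ on $\mathbb{R}^N$ (here $-H$) and a subspace $V$, $\det(B|_V)$ is the determinant of $B$ regarded as a bilinear form on $V$, i.e. $\det(B|_V)=\det(B(z_i,z_j))_{i,j=1}^r/\det(\langle z_i,z_j\rangle)_{i,j=1}^r$ for any basis $z_1,\dots,z_r$ of $V$. $nK=\{nx:x\in K\}$. *)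

theory Defs
  imports
    "HOL-Analysis.Analysis"
    "HOL-Library.Landau_Symbols"
    "Jordan_Normal_Form.Determinant"
begin

section \<open>Gram determinants\<close>

text \<open>The determinant is the one of Jordan_Normal_Form, whose matrices have a
  size that is a natural number and not a type; \<open>HOL-Analysis\<close> has another constant
  of the same base name. For the empty list the value is 1.\<close>

definition gram_det :: "('a \<Rightarrow> 'a \<Rightarrow> real) \<Rightarrow> 'a list \<Rightarrow> real" where
  "gram_det B zs =
     Determinant.det (Matrix.mat (length zs) (length zs) (\<lambda>(i, j). B (zs ! i) (zs ! j)))"

definition is_basis_list :: "'a::euclidean_space set \<Rightarrow> 'a list \<Rightarrow> bool" where
  "is_basis_list V zs \<longleftrightarrow> distinct zs \<and> independent (set zs) \<and> span (set zs) = V"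

text \<open>The determinant of a bilinear form on the subspace \<open>V\<close>. Numerator and denominator
  are both multiplied by the square of the determinant of the transition matrix under a
  change of basis, so the quotient does not depend on the chosen basis.\<close>

definition form_det_on :: "('a::euclidean_space \<Rightarrow> 'a \<Rightarrow> real) \<Rightarrow> 'a set \<Rightarrow> real" where
  "form_det_on B V =
     (let zs = (SOME zs. is_basis_list V zs) in gram_det B zs / gram_det (\<bullet>) zs)"

section \<open>Lattices\<close>

definition is_lattice :: "'a::euclidean_space set \<Rightarrow> bool" where
  "is_lattice L \<longleftrightarrow>
     0 \<in> L \<and> (\<forall>x\<in>L. \<forall>y\<in>L. x + y \<in> L) \<and> (\<forall>x\<in>L. - x \<in> L) \<and> discrete L"

text \<open>Uniqueness of the integer coefficients follows from linear independence.\<close>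

definition is_lattice_basis :: "'a::euclidean_space set \<Rightarrow> 'a list \<Rightarrow> bool" where
  "is_lattice_basis L xs \<longleftrightarrow>
     distinct xs \<and> independent (set xs) \<and>
     L = {\<Sum>i<length xs. of_int (c i) *\<^sub>R (xs ! i) | c :: nat \<Rightarrow> int. True}"

definition is_lattice_of_rank :: "'a::euclidean_space set \<Rightarrow> nat \<Rightarrow> bool" where
  "is_lattice_of_rank L r \<longleftrightarrow> is_lattice L \<and> (\<exists>xs. is_lattice_basis L xs \<and> length xs = r)"

text \<open>The \<open>r\<close>-dimensional volume of the unit cell \<open>{\<Sum>i. t i *\<^sub>R x i | 0 \<le> t i < 1}\<close>, given by
  the Gram determinant of a basis. It does not depend on the basis, since two bases of a lattice
  are related by an integer matrix of determinant 1 or -1.\<close>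

definition lattice_vol :: "'a::euclidean_space set \<Rightarrow> real" where
  "lattice_vol L = sqrt (gram_det (\<bullet>) (SOME xs. is_lattice_basis L xs))"

section \<open>Second derivatives\<close>

text \<open>Intended for open \<open>U\<close>.\<close>

definition C2_on :: "'a::euclidean_space set \<Rightarrow> ('a \<Rightarrow> real) \<Rightarrow> bool" where
  "C2_on U f \<longleftrightarrow>
     (\<exists>(D :: 'a \<Rightarrow> 'a \<Rightarrow>\<^sub>L real) (D2 :: 'a \<Rightarrow> 'a \<Rightarrow>\<^sub>L 'a \<Rightarrow>\<^sub>L real).
        (\<forall>x\<in>U. (f has_derivative blinfun_apply (D x)) (at x)) \<and>
        (\<forall>x\<in>U. (D has_derivative blinfun_apply (D2 x)) (at x)) \<and>
        continuous_on U D2)"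

text \<open>The Hessian as a bilinear form: \<open>hessian f x u v\<close> is the derivative in direction \<open>u\<close>,
  at \<open>x\<close>, of the directional derivative of \<open>f\<close> in direction \<open>v\<close>.\<close>

definition hessian :: "('a::euclidean_space \<Rightarrow> real) \<Rightarrow> 'a \<Rightarrow> 'a \<Rightarrow> 'a \<Rightarrow> real" where
  "hessian f x u v = frechet_derivative (\<lambda>y. frechet_derivative f (at y) v) (at x) u"

section \<open>Landau symbols, uniform over an index set that varies with n\<close>

definition unif_bigo :: "(nat \<Rightarrow> 'a set) \<Rightarrow> (nat \<Rightarrow> 'a \<Rightarrow> real) \<Rightarrow> (nat \<Rightarrow> 'a \<Rightarrow> real) \<Rightarrow> bool" where
  "unif_bigo S f g \<longleftrightarrow>
     (\<exists>C>0. \<forall>\<^sub>F n in sequentially. \<forall>x\<in>S n. \<bar>f n x\<bar> \<le> C * \<bar>g n x\<bar>)"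

definition unif_smallo :: "(nat \<Rightarrow> 'a set) \<Rightarrow> (nat \<Rightarrow> 'a \<Rightarrow> real) \<Rightarrow> (nat \<Rightarrow> 'a \<Rightarrow> real) \<Rightarrow> bool" where
  "unif_smallo S f g \<longleftrightarrow>
     (\<forall>c>0. \<forall>\<^sub>F n in sequentially. \<forall>x\<in>S n. \<bar>f n x\<bar> \<le> c * \<bar>g n x\<bar>)"

text \<open>\<open>lattice_pts L l K n\<close> is the set \<open>(L + l n) \<inter> n K\<close>.\<close>

definition lattice_pts ::
    "'a::euclidean_space set \<Rightarrow> (nat \<Rightarrow> 'a) \<Rightarrow> 'a set \<Rightarrow> nat \<Rightarrow> 'a set" where
  "lattice_pts L l K n = (\<lambda>x. x + l n) ` L \<inter> (\<lambda>x. real n *\<^sub>R x) ` K"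

end

theory Submission
  imports Defs "HOL-Probability.Distributions" "HOL-Real_Asymp.Real_Asymp"
begin

text \<open>This is Laplace's method on a lattice. On \<open>V\<close> the form \<open>B = -H\<close> is semidefinite because
  \<open>x\<^sub>0\<close> is a maximum, hence positive definite because its determinant does not vanish. After
  division by \<open>b\<^sub>n exp (n \<phi>(x\<^sub>0))\<close>, the summand at \<open>x\<^sub>0 + y\<close> is close to
  \<open>\<psi>(x\<^sub>0) exp (-n B(y,y)/2)\<close> near \<open>x\<^sub>0\<close>, and elsewhere both are at most
  \<open>C exp (-\<kappa> n) exp (-\<tau> n B(y,y)/2)\<close>, so everything reduces to sums of Gaussians over shifted
  lattices and no lattice points have to be counted. Completing the square with respect to the first
  basis vector splits such a sum into a one-dimensional Gaussian sum, which is within twice the mesh of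
  its integral for every shift, and a Gaussian sum for the Schur complement over the lattice spanned by
  the remaining basis vectors.\<close>

section \<open>One-dimensional Gaussian sums\<close>

text \<open>The vectors \<open>l n\<close> are arbitrary, so after rescaling by
  \<open>sqrt n\<close> the shifts of the lattice need not converge or even stay bounded; every
  estimate for a Gaussian sum therefore has to be uniform in the shift. The same uniformity drives
  the induction on the rank, because the one-dimensional shift produced by completing the square
  varies with the remaining coordinates. The pivots \<open>B x x\<close> met on the way are those of
  Gaussian elimination, and their product is the Gram determinant in the limit. Near
  \<open>x\<^sub>0\<close> the exponent is known only up to a relative error \<eta>, and \<eta>
  times the exponent may still grow with n, so the ratio of the summand to its Gaussian is not
  controlled. Instead both exponentials lie between the Gaussians with exponents scaled by 1 -
  \<eta> and 1 + \<eta>, whose normalised sums have limits depending continuously on \<eta>. Away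
  from \<open>x\<^sub>0\<close> a weight exp (-\<tau> q) can be split off the exponential gain
  because q is at most a multiple of n on the bounded set \<open>K\<close>; this weight makes the
  far terms summable over the whole lattice, with a sum of order n^(r/2).\<close>

lemma gaussian_antiderivative:
  obtains F :: "real \<Rightarrow> real" where
    "\<And>x. (F has_real_derivative exp (- x\<^sup>2)) (at x)"
    "(F \<longlongrightarrow> sqrt pi / 2) at_top" "(F \<longlongrightarrow> - sqrt pi / 2) at_bot"
proof -
  define F where "F = (\<lambda>x. LBINT y=0..ereal x. exp (- y\<^sup>2))"
  have D: "(F has_real_derivative exp (- x\<^sup>2)) (at x)" for x :: real
  proof -
    define c where "c = \<bar>x\<bar> + 1"
    have "((\<lambda>u. LBINT y=ereal 0..ereal u. exp (- y\<^sup>2)) has_vector_derivative exp (- x\<^sup>2)) (at x within {-c..c})"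
      by (rule interval_integral_FTC2) (auto simp: c_def intro!: continuous_intros)
    moreover have "at x within {-c..c} = at x"
      by (rule at_within_Icc_at) (auto simp: c_def)
    ultimately show ?thesis
      by (simp add: F_def has_real_derivative_iff_has_vector_derivative zero_ereal_def)
  qed
  have top: "(F \<longlongrightarrow> sqrt pi / 2) at_top"
  proof -
    let ?f = "\<lambda>x::real. indicator {0..} x *\<^sub>R exp (- x\<^sup>2) :: real"
    have "((\<lambda>y. \<integral> x. indicator {..y} x *\<^sub>R ?f x \<partial>lborel) \<longlongrightarrow> (\<integral> x. ?f x \<partial>lborel)) at_top"
      by (rule tendsto_integral_at_top)
        (use gaussian_moment_0 in \<open>auto simp: has_bochner_integral_iff\<close>)
    also have "(\<integral> x. ?f x \<partial>lborel) = sqrt pi / 2"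
      using gaussian_moment_0 by (simp add: has_bochner_integral_iff)
    finally show ?thesis
    proof (rule Lim_transform_eventually)
      show "\<forall>\<^sub>F y in at_top. (\<integral> x. indicator {..y} x *\<^sub>R ?f x \<partial>lborel) = F y"
        using eventually_ge_at_top[of 0]
      proof eventually_elim
        case (elim y)
        have "F y = (LBINT x=ereal 0..ereal y. exp (- x\<^sup>2))"
          by (simp add: F_def zero_ereal_def)
        also have "\<dots> = (LBINT x:{0..y}. exp (- x\<^sup>2))"
          by (rule interval_integral_Icc) (use elim in auto)
        also have "\<dots> = (\<integral> x. indicator {..y} x *\<^sub>R ?f x \<partial>lborel)"
          unfolding set_lebesgue_integral_def
          by (rule Bochner_Integration.integral_cong) (auto simp: indicator_def)
        finally show ?case ..
      qed
    qed
  qed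
  \<comment> \<open>The limit at minus infinity follows from the one at plus infinity by
    symmetry.\<close>
  have odd: "F (- x) = - F x" for x
  proof -
    have "((\<lambda>x. F x + F (- x)) has_real_derivative 0) (at x)" for x
    proof -
      have "((\<lambda>x. F (- x)) has_real_derivative exp (- (- x)\<^sup>2) * (- 1)) (at x)"
        by (rule DERIV_chain2[OF D]) (auto intro!: derivative_eq_intros)
      from DERIV_add[OF D this]
      show ?thesis by simp
    qed
    hence "F x + F (- x) = F 0 + F (- 0)"
      using DERIV_isconst_all[of "\<lambda>x. F x + F (- x)" x 0] by auto
    moreover have "F 0 = 0" by (simp add: F_def zero_ereal_def)
    ultimately show ?thesis by simp
  qed
  have "((\<lambda>x. - F (- x)) \<longlongrightarrow> - (sqrt pi / 2)) at_bot"
    by (rule tendsto_minus, rule filterlim_compose[OF top filterlim_uminus_at_top_at_bot])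
  hence "(F \<longlongrightarrow> - sqrt pi / 2) at_bot" by (simp add: odd)
  with D top show ?thesis by (rule that)
qed

text \<open>The error of the left Riemann sum on a cell is at most the mesh times the increment of the
  total variation \<open>T\<close> of the Gaussian, so the errors telescope.\<close>

lemma gaussian_cell_bound:
  fixes h u :: real
  assumes F: "\<And>x. (F has_real_derivative exp (- x\<^sup>2)) (at x)" and h: "h > 0"
  defines "T \<equiv> \<lambda>x::real. if x \<le> 0 then exp (- x\<^sup>2) else 2 - exp (- x\<^sup>2)"
  shows "\<bar>h * exp (- u\<^sup>2) - (F (u + h) - F u)\<bar> \<le> h * (T (u + h) - T u)"
proof -
  have "\<exists>z. u < z \<and> z < u + h \<and> F (u + h) - F u = (u + h - u) * exp (- z\<^sup>2)"
    by (rule MVT2) (use h F in auto)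
  then obtain z where z: "u < z" "z < u + h" "F (u + h) - F u = h * exp (- z\<^sup>2)" by auto
  \<comment> \<open>On either side of the origin \<open>T\<close> changes by exactly the absolute
    change of the Gaussian; across the origin the inequality holds because both Gaussian values are
    at most 1.\<close>
  have var: "\<bar>exp (- x\<^sup>2) - exp (- y\<^sup>2)\<bar> \<le> T y - T x" if "x \<le> y" for x y :: real
  proof -
    have neg: "exp (- x\<^sup>2) \<le> exp (- y\<^sup>2)" if "x \<le> y" "y \<le> 0" for x y :: real
      using power_mono[of "-y" "-x" 2] that by simp
    have pos: "exp (- y\<^sup>2) \<le> exp (- x\<^sup>2)" if "x \<le> y" "0 \<le> x" for x y :: real
      using power_mono[of x y 2] that by simp
    have one: "exp (- x\<^sup>2) \<le> 1" for x :: real by simp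
    show ?thesis
      using neg[of x y] pos[of x y] one[of x] one[of y] that
      unfolding T_def abs_le_iff by (auto simp: not_le intro: less_imp_le)
  qed
  have mono: "T z \<le> T (u + h)" using var[of z "u + h"] z by simp
  have "\<bar>h * exp (- u\<^sup>2) - (F (u + h) - F u)\<bar> = h * \<bar>exp (- u\<^sup>2) - exp (- z\<^sup>2)\<bar>"
    unfolding z(3) right_diff_distrib[symmetric] abs_mult using h by simp
  also have "\<dots> \<le> h * (T z - T u)" using var[of u z] z h by (intro mult_left_mono) auto
  also have "\<dots> \<le> h * (T (u + h) - T u)" using mono h by (intro mult_left_mono) auto
  finally show ?thesis .
qed

text \<open>The factor 2 is the total variation of the Gaussian: the cell errors telescope to a
  difference of values of \<open>T\<close>, which stays between 0 and 2 whatever the shift.\<close>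

lemma gaussian_sum_unit:
  fixes h t :: real
  assumes h: "h > 0"
  shows "\<exists>S. ((\<lambda>k::int. exp (- (h * of_int k + t)\<^sup>2)) has_sum S) UNIV \<and> \<bar>h * S - sqrt pi\<bar> \<le> 2 * h"
proof -
  obtain F :: "real \<Rightarrow> real" where F: "\<And>x. (F has_real_derivative exp (- x\<^sup>2)) (at x)"
    "(F \<longlongrightarrow> sqrt pi / 2) at_top" "(F \<longlongrightarrow> - sqrt pi / 2) at_bot"
    using gaussian_antiderivative by blast
  define T where "T = (\<lambda>x::real. if x \<le> 0 then exp (- x\<^sup>2) else 2 - exp (- x\<^sup>2))"
  have T: "0 \<le> T x" "T x \<le> 2" for x
    by (auto simp: T_def intro: order_trans[of _ 1])
  define g where "g = (\<lambda>k::int. exp (- (h * of_int k + t)\<^sup>2))"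
  have g0: "g k \<ge> 0" for k by (simp add: g_def)
  have mono_F: "F x \<le> F y" if "x \<le> y" for x y
    by (rule DERIV_nonneg_imp_nondecreasing[OF that]) (use F(1) in force)
  \<comment> \<open>Half-open windows: the cells with left endpoints indexed by \<open>A N\<close>
    tile the interval from \<open>t - h * N\<close> to \<open>t + h * N\<close> exactly.\<close>
  define A where "A = (\<lambda>N::nat. {- int N..<int N})"
  define G where "G = (\<lambda>N::nat. F (h * real N + t) - F (t - h * real N))"
  have part: "\<bar>h * sum g (A N) - G N\<bar> \<le> h * 2" for N
  proof -
    let ?p = "\<lambda>k::int. h * of_int k + t"
    have tele: "(\<Sum>k\<in>A N. f (k + 1) - f k) = f (int N) - f (- int N)" for f :: "int \<Rightarrow> real"
    proof (induction N)
      case (Suc N)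
      have "A (Suc N) = insert (- int (Suc N)) (insert (int N) (A N))"
        by (auto simp: A_def)
      moreover have "- int (Suc N) \<notin> insert (int N) (A N)" "int N \<notin> A N" "finite (A N)"
        by (auto simp: A_def)
      ultimately show ?case using Suc.IH by (simp add: add.commute)
    qed (simp add: A_def)
    have "(\<Sum>k\<in>A N. F (?p (k + 1)) - F (?p k)) = G N"
      using tele[of "\<lambda>k. F (?p k)"] by (simp add: G_def)
    hence "\<bar>h * sum g (A N) - G N\<bar> = \<bar>\<Sum>k\<in>A N. h * g k - (F (?p (k + 1)) - F (?p k))\<bar>"
      by (simp add: sum_subtractf[of "\<lambda>k. h * g k"] sum_distrib_left)
    also have "\<dots> \<le> (\<Sum>k\<in>A N. h * (T (?p (k + 1)) - T (?p k)))"
    proof (rule order_trans[OF sum_abs], rule sum_mono)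
      fix k
      show "\<bar>h * g k - (F (?p (k + 1)) - F (?p k))\<bar> \<le> h * (T (?p (k + 1)) - T (?p k))"
      proof -
        have "?p (k + 1) = ?p k + h" by (simp add: algebra_simps)
        thus ?thesis
          using gaussian_cell_bound[of F h "?p k", OF F(1) h] by (simp only: g_def T_def)
      qed
    qed
    also have "\<dots> = h * (T (?p (int N)) - T (?p (- int N)))"
      using tele[of "\<lambda>k. T (?p k)"] by (simp add: sum_distrib_left[symmetric])
    also have "\<dots> \<le> h * 2"
      using T(2)[of "?p (int N)"] T(1)[of "?p (- int N)"] h by (intro mult_left_mono) auto
    finally show ?thesis .
  qed
  have Glim: "G \<longlonglongrightarrow> sqrt pi"
  proof -
    have "filterlim (\<lambda>N. h * real N + t) at_top sequentially"
      "filterlim (\<lambda>N. t - h * real N) at_bot sequentially"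
      using h by real_asymp+
    from tendsto_diff[OF filterlim_compose[OF F(2) this(1)] filterlim_compose[OF F(3) this(2)]]
    show ?thesis by (simp add: G_def)
  qed
  then obtain B where B: "\<And>N. \<bar>G N\<bar> \<le> B"
    using convergent_imp_Bseq[of G] by (auto simp: convergent_def Bseq_def)
  \<comment> \<open>The windows are cofinal among the finite sets of integers, so the unordered sum
    can be computed as a limit along them.\<close>
  have sub: "\<exists>N0. \<forall>N\<ge>N0. X \<subseteq> A N" if "finite X" for X :: "int set"
  proof (intro exI allI impI subsetI)
    fix N k assume "N \<ge> nat (\<Sum>j\<in>X. \<bar>j\<bar>) + 1" "k \<in> X"
    moreover have "\<bar>k\<bar> \<le> (\<Sum>j\<in>X. \<bar>j\<bar>)" using \<open>k \<in> X\<close> that by (intro member_le_sum) auto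
    ultimately show "k \<in> A N" by (auto simp: A_def)
  qed
  have "g summable_on UNIV"
  proof (rule nonneg_bdd_above_summable_on)
    show "bdd_above (sum g ` {X. X \<subseteq> UNIV \<and> finite X})"
    proof (rule bdd_aboveI2)
      fix X :: "int set" assume "X \<in> {X. X \<subseteq> UNIV \<and> finite X}"
      then obtain N where "X \<subseteq> A N" using sub[of X] by auto
      hence "sum g X \<le> sum g (A N)" by (intro sum_mono2) (auto simp: A_def g0)
      also have "\<dots> \<le> (h * 2 + B) / h"
        using part[of N] B[of N] h by (simp add: field_simps abs_le_iff)
      finally show "sum g X \<le> (h * 2 + B) / h" .
    qed
  qed (rule g0)
  then obtain S where S: "(g has_sum S) UNIV" by (auto simp: summable_on_def)
  have "filterlim A (finite_subsets_at_top UNIV) sequentially"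
    unfolding filterlim_finite_subsets_at_top
  proof (intro allI impI)
    fix X :: "int set" assume "finite X \<and> X \<subseteq> UNIV"
    with sub[of X] obtain N0 where "\<forall>N\<ge>N0. X \<subseteq> A N" by auto
    thus "\<forall>\<^sub>F N in sequentially. finite (A N) \<and> X \<subseteq> A N \<and> A N \<subseteq> UNIV"
      by (auto simp: eventually_sequentially A_def)
  qed
  from filterlim_compose[OF S[unfolded has_sum_def] this]
  have "(\<lambda>N. sum g (A N)) \<longlonglongrightarrow> S" .
  hence "(\<lambda>N. \<bar>h * sum g (A N) - G N\<bar>) \<longlonglongrightarrow> \<bar>h * S - sqrt pi\<bar>"
    by (intro tendsto_intros Glim)
  hence "\<bar>h * S - sqrt pi\<bar> \<le> 2 * h"
    by (rule LIMSEQ_le_const2) (use part in \<open>auto simp: mult.commute\<close>)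
  with S show ?thesis unfolding g_def by blast
qed

text \<open>Rescaling by \<open>sqrt (d / 2)\<close> multiplies the mesh and the error by the same
  factor, so the constant 2 depends neither on \<open>d\<close> nor on \<open>t\<close>.\<close>

lemma gaussian_sum_1:
  fixes h d t :: real
  assumes h: "h > 0" and d: "d > 0"
  shows "\<exists>S. ((\<lambda>k::int. exp (- (d * (h * of_int k + t)\<^sup>2 / 2))) has_sum S) UNIV
           \<and> \<bar>h * S - sqrt (2 * pi / d)\<bar> \<le> 2 * h"
proof -
  define s where "s = sqrt (d / 2)"
  have s: "s > 0" "s\<^sup>2 = d / 2" using d by (auto simp: s_def)
  obtain S where S: "((\<lambda>k::int. exp (- (s * h * of_int k + s * t)\<^sup>2)) has_sum S) UNIV"
     "\<bar>s * h * S - sqrt pi\<bar> \<le> 2 * (s * h)"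
    using gaussian_sum_unit[of "s * h" "s * t"] s h by auto
  have sq: "(s * h * of_int k + s * t)\<^sup>2 = d * (h * of_int k + t)\<^sup>2 / 2" for k :: int
  proof -
    have "(s * h * of_int k + s * t)\<^sup>2 = s\<^sup>2 * (h * of_int k + t)\<^sup>2"
      by (simp add: power2_eq_square algebra_simps)
    thus ?thesis by (simp add: s)
  qed
  moreover have "sqrt (2 * pi / d) = sqrt pi / s"
    using d by (simp add: s_def real_sqrt_divide[symmetric] field_simps)
  moreover have "\<bar>h * S - sqrt pi / s\<bar> \<le> 2 * h"
  proof -
    have "\<bar>s * h * S - sqrt pi\<bar> = s * \<bar>h * S - sqrt pi / s\<bar>"
      using s by (simp add: abs_mult_pos' right_diff_distrib mult.assoc)
    thus ?thesis using S(2) s by (simp add: mult.left_commute)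
  qed
  ultimately show ?thesis using S(1) unfolding sq by auto
qed

section \<open>Lattices spanned by a list\<close>

text \<open>The recursive form lets an induction peel off one basis vector; the pair
  \<open>(v, k)\<close> has the outer summation variable first, as the double sum needs it.\<close>

fun zspan :: "'a::real_vector list \<Rightarrow> 'a set" where
  "zspan [] = {0}"
| "zspan (x # xs) = (\<lambda>(v, k). of_int k *\<^sub>R x + v) ` (zspan xs \<times> UNIV)"

lemma zspan_subset_span: "zspan xs \<subseteq> span (set xs)"
proof (induction xs)
  case (Cons x xs)
  have "span (set xs) \<subseteq> span (set (x # xs))" by (rule span_mono) auto
  with Cons.IH show ?case
    by (auto intro!: span_add[OF span_scale[OF span_base]])
qed (simp add: span_zero)

lemma zspan_eq: "zspan xs = {\<Sum>i<length xs. of_int (c i) *\<^sub>R (xs ! i) | c :: nat \<Rightarrow> int. True}"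
proof (induction xs)
  case (Cons x xs)
  show ?case
  proof (intro equalityI subsetI)
    fix y assume "y \<in> zspan (x # xs)"
    then obtain k c where y: "y = of_int k *\<^sub>R x + (\<Sum>i<length xs. of_int (c i) *\<^sub>R (xs ! i))"
      using Cons.IH by auto
    show "y \<in> {\<Sum>i<length (x # xs). of_int (c i) *\<^sub>R ((x # xs) ! i) | c :: nat \<Rightarrow> int. True}"
      by (intro CollectI exI[of _ "case_nat k c"]) (simp add: y sum.lessThan_Suc_shift del: sum.lessThan_Suc)
  next
    fix y assume "y \<in> {\<Sum>i<length (x # xs). of_int (c i) *\<^sub>R ((x # xs) ! i) | c :: nat \<Rightarrow> int. True}"
    then obtain c :: "nat \<Rightarrow> int" where "y = (\<Sum>i<length (x # xs). of_int (c i) *\<^sub>R ((x # xs) ! i))"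
      by auto
    hence "y = of_int (c 0) *\<^sub>R x + (\<Sum>i<length xs. of_int (c (Suc i)) *\<^sub>R (xs ! i))"
      by (simp add: sum.lessThan_Suc_shift del: sum.lessThan_Suc)
    moreover have "(\<Sum>i<length xs. of_int (c (Suc i)) *\<^sub>R (xs ! i)) \<in> zspan xs"
      unfolding Cons.IH by (intro CollectI exI[of _ "\<lambda>i. c (Suc i)"]) auto
    ultimately show "y \<in> zspan (x # xs)" by force
  qed
qed simp

text \<open>Two different coefficients of \<open>x\<close> would put \<open>x\<close> into the span
  of the other vectors. Injectivity allows a lattice sum to be rewritten as a double sum.\<close>

lemma zspan_Cons_inj:
  assumes "independent (set (x # xs))" "x \<notin> set xs"
  shows "inj_on (\<lambda>(v, k). of_int k *\<^sub>R x + v) (zspan xs \<times> UNIV)"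
proof (rule inj_onI, clarify)
  fix k k' v v' assume v: "v \<in> zspan xs" "v' \<in> zspan xs"
    and eq: "of_int k *\<^sub>R x + v = of_int k' *\<^sub>R x + v'"
  have x: "x \<notin> span (set xs)"
    using assms by (auto simp: independent_insert)
  have "v' - v \<in> span (set xs)" using v zspan_subset_span[of xs] by (auto intro: span_diff)
  moreover have "v' - v = (of_int k - of_int k') *\<^sub>R x"
    using eq by (simp add: algebra_simps)
  ultimately have "k = k'"
    using x span_scale[of "v' - v" "set xs" "inverse (of_int k - of_int k')"] by (cases "k = k'") auto
  with eq show "v = v' \<and> k = k'" by simp
qed

section \<open>Gram determinants and Schur complements\<close>

text \<open>The Schur complement of the entry \<open>B x x\<close>. If \<open>B x x > 0\<close>,
  then \<open>schur B x v v\<close> is the minimum of the quadratic form of \<open>B\<close> on the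
  line through \<open>v\<close> in direction \<open>x\<close>.\<close>

definition schur :: "('a \<Rightarrow> 'a \<Rightarrow> real) \<Rightarrow> 'a \<Rightarrow> 'a \<Rightarrow> 'a \<Rightarrow> real" where
  "schur B x u v = B u v - B x u * B x v / B x x"

lemma gram_det_Nil [simp]: "gram_det B [] = 1"
  by (simp add: gram_det_def)

text \<open>One step of Gaussian elimination with pivot \<open>B x x\<close>; the remaining block is
  the Gram matrix of the Schur complement.\<close>

lemma gram_det_Cons:
  assumes sym: "\<And>u v. B u v = B v u" and nz: "B x x \<noteq> 0"
  shows "gram_det B (x # xs) = B x x * gram_det (schur B x) xs"
proof -
  define n where "n = length xs"
  \<comment> \<open>Unit lower triangular: left multiplication by \<open>E\<close> clears the first
    column below the pivot without changing the determinant.\<close>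
  define E where "E = four_block_mat (1\<^sub>m 1) (0\<^sub>m 1 n)
     (Matrix.mat n 1 (\<lambda>(i, j). - B x (xs ! i) / B x x)) (1\<^sub>m n)"
  define G where "G = Matrix.mat (Suc n) (Suc n) (\<lambda>(i, j). B ((x # xs) ! i) ((x # xs) ! j))"
  define A4 where "A4 = Matrix.mat n n (\<lambda>(i, j). schur B x (xs ! i) (xs ! j))"
  define M where "M = four_block_mat (Matrix.mat 1 1 (\<lambda>_. B x x))
     (Matrix.mat 1 n (\<lambda>(i, j). B x (xs ! j))) (0\<^sub>m n 1) A4"
  have E: "E \<in> carrier_mat (Suc n) (Suc n)" and G: "G \<in> carrier_mat (Suc n) (Suc n)"
    by (auto simp: E_def G_def)
  have "Determinant.det E = Determinant.det (1\<^sub>m 1 :: real mat) * Determinant.det (1\<^sub>m n :: real mat)"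
    unfolding E_def by (rule det_four_block_mat_upper_right_zero[where n = 1 and m = n]) auto
  hence detE: "Determinant.det E = 1" by simp
  have G_split: "G = four_block_mat (Matrix.mat 1 1 (\<lambda>_. B x x)) (Matrix.mat 1 n (\<lambda>(i, j). B x (xs ! j)))
     (Matrix.mat n 1 (\<lambda>(i, j). B x (xs ! i))) (Matrix.mat n n (\<lambda>(i, j). B (xs ! i) (xs ! j)))"
    (is "_ = ?C")
  proof (rule eq_matI)
    fix i j assume "i < dim_row ?C" "j < dim_col ?C"
    hence "i < Suc n" "j < Suc n" by auto
    thus "G $$ (i, j) = ?C $$ (i, j)"
      by (cases i; cases j) (simp_all add: G_def sym[of "xs ! _" x])
  qed (auto simp: G_def)
  have "E * G = M"
    unfolding E_def G_split M_def
    apply (subst mult_four_block_mat[where ?nr1.0 = 1 and ?n1.0 = 1 and ?n2.0 = n and ?nr2.0 = n and ?nc1.0 = 1 and ?nc2.0 = n])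
    apply (simp_all add: A4_def)
    apply (intro arg_cong4[where f = four_block_mat] eq_matI)
               apply (simp_all add: scalar_prod_def schur_def nz)
    done
  hence "Determinant.det G = Determinant.det M"
    using det_mult[OF E G] detE by simp
  also have "\<dots> = Determinant.det (Matrix.mat 1 1 (\<lambda>_. B x x)) * Determinant.det A4"
    unfolding M_def by (rule det_four_block_mat_lower_left_zero_col) (auto simp: A4_def)
  also have "Determinant.det (Matrix.mat 1 1 (\<lambda>_. B x x)) = B x x"
    by (subst det_single) auto
  finally show ?thesis by (simp add: gram_det_def G_def A4_def n_def)
qed

text \<open>The two Gram matrices are congruent through the coefficient matrix \<open>P\<close>,
  which may be singular here.\<close>

lemma gram_det_change_basis:
  assumes B: "bilinear B" and len: "length zs = length xs"
    and z: "\<And>i. i < length xs \<Longrightarrow> zs ! i = (\<Sum>k<length xs. P i k *\<^sub>R (xs ! k))"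
  shows "gram_det B zs = (Determinant.det (Matrix.mat (length xs) (length xs) (\<lambda>(i, k). P i k)))\<^sup>2 * gram_det B xs"
proof -
  define n where "n = length xs"
  define Q where "Q = Matrix.mat n n (\<lambda>(i, k). P i k)"
  define G where "G = Matrix.mat n n (\<lambda>(i, j). B (xs ! i) (xs ! j))"
  have carr: "Q \<in> carrier_mat n n" "G \<in> carrier_mat n n" by (auto simp: Q_def G_def)
  have "Matrix.mat n n (\<lambda>(i, j). B (zs ! i) (zs ! j)) = Q * (G * transpose_mat Q)"
  proof (rule eq_matI)
    fix i j assume "i < dim_row (Q * (G * transpose_mat Q))" "j < dim_col (Q * (G * transpose_mat Q))"
    hence ij: "i < n" "j < n" using carr by auto
    have "B (zs ! i) (zs ! j) = (\<Sum>k<n. \<Sum>m<n. P i k * (P j m * B (xs ! k) (xs ! m)))"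
      using z ij bilinear_sum[OF B, of "\<lambda>k. P i k *\<^sub>R (xs ! k)" "{..<n}" "\<lambda>m. P j m *\<^sub>R (xs ! m)" "{..<n}"]
      by (simp add: n_def sum.cartesian_product bilinear_lmul[OF B] bilinear_rmul[OF B] mult.left_commute)
    thus "Matrix.mat n n (\<lambda>(i, j). B (zs ! i) (zs ! j)) $$ (i, j) = (Q * (G * transpose_mat Q)) $$ (i, j)"
      using ij by (simp add: Q_def G_def scalar_prod_def sum_distrib_left atLeast0LessThan mult_ac)
  qed (auto simp: Q_def G_def)
  thus ?thesis
    using carr len
    by (simp add: gram_det_def Q_def[symmetric] G_def[symmetric] n_def[symmetric] power2_eq_square
        det_mult[where n = n] det_transpose)
qed

lemma gram_det_cmult: "gram_det (\<lambda>u v. c * B u v) xs = c ^ length xs * gram_det B xs"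
proof -
  have "Matrix.mat (length xs) (length xs) (\<lambda>(i, j). c * B (xs ! i) (xs ! j))
     = c \<cdot>\<^sub>m Matrix.mat (length xs) (length xs) (\<lambda>(i, j). B (xs ! i) (xs ! j))"
    by (rule eq_matI) auto
  thus ?thesis by (simp add: gram_det_def)
qed

lemma schur_props:
  assumes B: "bilinear B" and sym: "\<And>u v. B u v = B v u" and pos: "B x x > 0"
  shows "bilinear (schur B x)" "schur B x u v = schur B x v u"
    "B (s *\<^sub>R x + v) (s *\<^sub>R x + v) = B x x * (s + B x v / B x x)\<^sup>2 + schur B x v v"
proof -
  note lin = bilinear_ladd[OF B] bilinear_radd[OF B] bilinear_lmul[OF B] bilinear_rmul[OF B]
  show "bilinear (schur B x)"
    unfolding bilinear_def by (auto intro!: linearI simp: schur_def lin add_divide_distrib algebra_simps)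
  show "schur B x u v = schur B x v u" by (simp add: schur_def sym mult.commute)
  show "B (s *\<^sub>R x + v) (s *\<^sub>R x + v) = B x x * (s + B x v / B x x)\<^sup>2 + schur B x v v"
    using pos by (simp add: schur_def lin sym[of v x] power2_eq_square field_simps)
qed

text \<open>The Schur complement at \<open>v\<close> is the value of \<open>B\<close> at the
  minimiser on the line through \<open>v\<close> in direction \<open>x\<close>, and that line misses
  0 because \<open>x\<close> is outside the span of \<open>xs\<close>.\<close>

lemma schur_pos_def:
  assumes B: "bilinear B" and sym: "\<And>u v. B u v = B v u"
    and pos: "\<And>v. v \<in> span (set (x # xs)) \<Longrightarrow> v \<noteq> 0 \<Longrightarrow> B v v > 0"
    and x: "x \<notin> span (set xs)" and v: "v \<in> span (set xs)" "v \<noteq> 0"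
  shows "schur B x v v > 0"
proof -
  have sub: "span (set xs) \<subseteq> span (set (x # xs))" by (rule span_mono) auto
  have "x \<noteq> 0" using x span_zero by auto
  hence px: "B x x > 0" by (intro pos) (auto intro: span_base)
  define s where "s = - (B x v / B x x)"
  have "s *\<^sub>R x + v \<noteq> 0"
  proof
    assume 0: "s *\<^sub>R x + v = 0"
    hence "s \<noteq> 0" using v by auto
    moreover have "s *\<^sub>R x = - v" using 0 by (simp add: eq_neg_iff_add_eq_0)
    hence "s *\<^sub>R x \<in> span (set xs)" using v by (simp add: span_neg)
    ultimately show False using x span_scale[of "s *\<^sub>R x" "set xs" "inverse s"] by simp
  qed
  moreover have "s *\<^sub>R x + v \<in> span (set (x # xs))"
    using v sub by (intro span_add[OF span_scale[OF span_base]]) auto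
  ultimately have "B (s *\<^sub>R x + v) (s *\<^sub>R x + v) > 0" by (rule pos[rotated])
  moreover have "s + B x v / B x x = 0" by (simp add: s_def)
  ultimately show ?thesis unfolding schur_props(3)[OF B sym px] by simp
qed

text \<open>The determinant is the product of the successive pivots, each positive because positive
  definiteness passes to Schur complements.\<close>

lemma gram_det_pos:
  assumes "bilinear B" "\<And>u v. B u v = B v u" "distinct xs" "independent (set xs)"
    "\<And>v. v \<in> span (set xs) \<Longrightarrow> v \<noteq> 0 \<Longrightarrow> B v v > 0"
  shows "gram_det B xs > 0"
  using assms
proof (induction xs arbitrary: B)
  case (Cons x xs)
  have x: "x \<notin> span (set xs)" and ind: "independent (set xs)"
    using Cons.prems by (auto simp: independent_insert)
  have "x \<noteq> 0" using x span_zero by auto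
  hence px: "B x x > 0" by (intro Cons.prems) (auto intro: span_base)
  have "gram_det (schur B x) xs > 0"
    using Cons.prems(3) ind schur_props(1,2)[OF Cons.prems(1,2) px]
      schur_pos_def[OF Cons.prems(1,2,5) x]
    by (intro Cons.IH) auto
  thus ?case using px by (simp add: gram_det_Cons Cons.prems(2))
qed simp

lemma span_list_coeffs:
  assumes "v \<in> span (set xs)"
  obtains c where "v = (\<Sum>k<length xs. c k *\<^sub>R (xs ! k))"
proof -
  have "\<exists>c. v = (\<Sum>k<length xs. c k *\<^sub>R (xs ! k))"
    using assms
  proof (induction xs arbitrary: v)
    case (Cons x xs)
    then obtain s where "v - s *\<^sub>R x \<in> span (set xs)"
      by (auto simp: span_insert)
    with Cons.IH obtain c where c: "v - s *\<^sub>R x = (\<Sum>k<length xs. c k *\<^sub>R (xs ! k))" by blast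
    hence "v = s *\<^sub>R x + (\<Sum>k<length xs. c k *\<^sub>R (xs ! k))" by (simp add: algebra_simps)
    thus ?case
      by (intro exI[of _ "case_nat s c"]) (simp add: sum.lessThan_Suc_shift del: sum.lessThan_Suc)
  qed simp
  thus ?thesis using that by blast
qed

text \<open>This makes the arbitrary choice of a basis in \<open>form_det_on\<close> harmless: both
  Gram determinants acquire the same factor \<open>p\<close>.\<close>

lemma gram_det_basis_quotient:
  fixes B :: "'a::euclidean_space \<Rightarrow> 'a \<Rightarrow> real"
  assumes B: "bilinear B" and zs: "is_basis_list V zs" and xs: "is_basis_list V xs"
  shows "gram_det B zs / gram_det inner zs = gram_det B xs / gram_det inner xs"
    and "length zs = length xs" and "gram_det inner xs > 0"
proof -
  have card: "length ys = dim V" if "is_basis_list V ys" for ys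
    using that dim_span_eq_card_independent[of "set ys"]
    by (auto simp: is_basis_list_def distinct_card)
  show len: "length zs = length xs" using card zs xs by simp
  have gpos: "gram_det inner ys > 0" if "is_basis_list V ys" for ys
    using that by (intro gram_det_pos bilinear_conv_bounded_bilinear[THEN iffD2] bounded_bilinear_inner)
      (auto simp: is_basis_list_def inner_commute)
  show "gram_det inner xs > 0" using gpos xs .
  have "\<exists>c. zs ! i = (\<Sum>k<length xs. c k *\<^sub>R (xs ! k))" if "i < length xs" for i
  proof -
    have "zs ! i \<in> span (set zs)" using that len by (auto intro: span_base)
    thus ?thesis using zs xs span_list_coeffs[of "zs ! i" xs] by (metis is_basis_list_def)
  qed
  then obtain P where P: "\<And>i. i < length xs \<Longrightarrow> zs ! i = (\<Sum>k<length xs. P i k *\<^sub>R (xs ! k))"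
    by metis
  define p where "p = (Determinant.det (Matrix.mat (length xs) (length xs) (\<lambda>(i, k). P i k)))\<^sup>2"
  have eq: "gram_det C zs = p * gram_det C xs" if "bilinear C" for C :: "'a \<Rightarrow> 'a \<Rightarrow> real"
    unfolding p_def by (rule gram_det_change_basis) (use that len P in auto)
  have inner: "bilinear (inner :: 'a \<Rightarrow> 'a \<Rightarrow> real)"
    by (simp add: bilinear_conv_bounded_bilinear bounded_bilinear_inner)
  \<comment> \<open>If \<open>p\<close> were 0, the positive Gram determinant of \<open>zs\<close>
    for the inner product would vanish; no inverse transition matrix is needed.\<close>
  have "p \<noteq> 0" using gpos[OF zs] eq[OF inner] by auto
  thus "gram_det B zs / gram_det inner zs = gram_det B xs / gram_det inner xs"
    using eq[OF B] eq[OF inner] by simp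
qed

text \<open>By Cauchy-Schwarz an isotropic vector of a semidefinite form lies in its radical, so its
  coordinates form a kernel vector of the Gram matrix.\<close>

lemma psd_nondegenerate_pos_def:
  fixes B :: "'a::real_vector \<Rightarrow> 'a \<Rightarrow> real"
  assumes B: "bilinear B" and sym: "\<And>u v. B u v = B v u"
    and psd: "\<And>v. v \<in> span (set xs) \<Longrightarrow> B v v \<ge> 0"
    and nz: "gram_det B xs \<noteq> 0" and v: "v \<in> span (set xs)" "v \<noteq> 0"
  shows "B v v > 0"
proof (rule ccontr)
  note lin = bilinear_ladd[OF B] bilinear_radd[OF B] bilinear_lmul[OF B] bilinear_rmul[OF B]
  assume "\<not> B v v > 0"
  with psd[OF v(1)] have v0: "B v v = 0" by simp
  have rad: "B u v = 0" if u: "u \<in> span (set xs)" for u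
  proof (rule ccontr)
    assume nz: "B u v \<noteq> 0"
    \<comment> \<open>Chosen so that the form takes the value -1 at
      \<open>u + s *\<^sub>R v\<close>, contradicting semidefiniteness.\<close>
    define s where "s = - (B u u + 1) / (2 * B u v)"
    have "B (u + s *\<^sub>R v) (u + s *\<^sub>R v) = B u u + 2 * s * B u v"
      by (simp add: lin v0 sym[of v u])
    also have "2 * s * B u v = - (B u u + 1)" using nz by (simp add: s_def)
    also have "B u u + - (B u u + 1) = - 1" by simp
    finally show False using psd[of "u + s *\<^sub>R v"] u v by (simp add: span_add span_scale)
  qed
  obtain c where c: "v = (\<Sum>k<length xs. c k *\<^sub>R (xs ! k))" using span_list_coeffs v by blast
  define n where "n = length xs"
  define G where "G = Matrix.mat n n (\<lambda>(i, j). B (xs ! i) (xs ! j))"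
  have "\<exists>k<n. c k \<noteq> 0"
  proof (rule ccontr)
    assume "\<not> (\<exists>k<n. c k \<noteq> 0)"
    hence "v = 0" unfolding c n_def by (intro sum.neutral) auto
    with v show False by simp
  qed
  hence "Matrix.vec n c \<noteq> 0\<^sub>v n" by (auto simp: vec_eq_iff)
  moreover have "G *\<^sub>v Matrix.vec n c = 0\<^sub>v n"
  proof (rule eq_vecI)
    fix i assume "i < dim_vec (0\<^sub>v n :: real Matrix.vec)"
    hence i: "i < n" by simp
    have "linear (B (xs ! i))" using B by (simp add: bilinear_def)
    hence "(\<Sum>k<n. c k * B (xs ! i) (xs ! k)) = B (xs ! i) v"
      unfolding c n_def by (simp add: lin linear_sum)
    also have "\<dots> = 0" using i by (intro rad span_base) (simp add: n_def)
    finally show "Matrix.vec_index (G *\<^sub>v Matrix.vec n c) i = Matrix.vec_index (0\<^sub>v n) i"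
      using i by (simp add: G_def scalar_prod_def atLeast0LessThan mult.commute)
  qed (simp add: G_def)
  moreover have "G \<in> carrier_mat n n" "Matrix.vec n c \<in> carrier_vec n" by (auto simp: G_def)
  ultimately have "Determinant.det G = 0" using det_0_iff_vec_prod_zero[of G n] by blast
  with nz show False by (simp add: gram_det_def G_def n_def)
qed

section \<open>The Gaussian sum over a lattice of arbitrary rank\<close>

text \<open>Summing first along \<open>x\<close> gives nearly the same value \<open>J / h\<close>
  for every \<open>v\<close>, so the double sum nearly factors into \<open>J / h\<close> and the
  Gaussian sum of the Schur complement. One constant \<open>C\<close> has to serve all
  shifts.\<close>

lemma gaussian_lattice_sum:
  fixes B :: "'a::real_vector \<Rightarrow> 'a \<Rightarrow> real"
  assumes "bilinear B" "\<And>u v. B u v = B v u" "distinct xs" "independent (set xs)"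
    "\<And>v. v \<in> span (set xs) \<Longrightarrow> v \<noteq> 0 \<Longrightarrow> B v v > 0"
  shows "\<exists>C\<ge>0. \<forall>h t. 0 < h \<longrightarrow> h \<le> 1 \<longrightarrow> t \<in> span (set xs) \<longrightarrow>
    (\<exists>S. ((\<lambda>v. exp (- (B (h *\<^sub>R v + t) (h *\<^sub>R v + t) / 2))) has_sum S) (zspan xs) \<and>
      \<bar>h ^ length xs * S - sqrt ((2 * pi) ^ length xs / gram_det B xs)\<bar> \<le> C * h)"
  using assms
proof (induction xs arbitrary: B)
  case Nil
  have "B 0 0 = 0" using Nil.prems(1) by (rule bilinear_lzero)
  thus ?case by (intro exI[of _ 0]) (auto intro!: exI[of _ 1] has_sum_finiteI)
next
  case (Cons x xs)
  note B = Cons.prems(1) and sym = Cons.prems(2) and pos = Cons.prems(5)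
  let ?n = "length xs" and ?B' = "schur B x"
  have x: "x \<notin> span (set xs)" and ind: "independent (set xs)" and dist: "distinct xs"
    using Cons.prems by (auto simp: independent_insert)
  have "x \<noteq> 0" using x span_zero by auto
  hence px: "B x x > 0" by (intro pos) (auto intro: span_base)
  note sch = schur_props[OF B sym px]
  have pos': "?B' v v > 0" if "v \<in> span (set xs)" "v \<noteq> 0" for v
    using schur_pos_def[OF B sym pos x] that by blast
  define I where "I = sqrt ((2 * pi) ^ ?n / gram_det ?B' xs)"
  define J where "J = sqrt (2 * pi / B x x)"
  have g': "gram_det ?B' xs > 0" by (rule gram_det_pos) (use sch dist ind pos' in auto)
  have IJ: "I \<ge> 0" "J \<ge> 0" using g' px by (auto simp: I_def J_def)
  have IJ_eq: "sqrt ((2 * pi) ^ length (x # xs) / gram_det B (x # xs)) = J * I"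
    unfolding I_def J_def real_sqrt_mult[symmetric] using px sym by (simp add: gram_det_Cons)
  from Cons.IH[OF sch(1,2) dist ind pos'] obtain C where C: "C \<ge> 0"
    "\<And>h t. 0 < h \<Longrightarrow> h \<le> 1 \<Longrightarrow> t \<in> span (set xs) \<Longrightarrow>
      \<exists>S. ((\<lambda>v. exp (- (?B' (h *\<^sub>R v + t) (h *\<^sub>R v + t) / 2))) has_sum S) (zspan xs) \<and>
        \<bar>h ^ ?n * S - I\<bar> \<le> C * h"
    unfolding I_def by blast
  show ?case
  proof (rule exI[of _ "2 * (I + C) + J * C"], intro conjI allI impI)
    show "2 * (I + C) + J * C \<ge> 0" using IJ C(1) by simp
    fix h :: real and t
    assume h: "0 < h" "h \<le> 1" and "t \<in> span (set (x # xs))"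
    then obtain s where s: "t - s *\<^sub>R x \<in> span (set xs)" by (auto simp: span_insert)
    define t' where "t' = t - s *\<^sub>R x"
    define e where "e = (\<lambda>v. exp (- (?B' (h *\<^sub>R v + t') (h *\<^sub>R v + t') / 2)))"
    obtain S where S: "(e has_sum S) (zspan xs)" "\<bar>h ^ ?n * S - I\<bar> \<le> C * h"
      using C(2)[OF h s] unfolding e_def t'_def by blast
    \<comment> \<open>The shift of the inner sum depends on \<open>v\<close>; only a one-dimensional
      bound that is uniform in the shift can be applied to all \<open>v\<close> at once.\<close>
    define sh where "sh = (\<lambda>v. s + B x (h *\<^sub>R v + t') / B x x)"
    have "\<exists>R. ((\<lambda>k::int. exp (- (B x x * (h * of_int k + sh v)\<^sup>2 / 2))) has_sum R) UNIV
           \<and> \<bar>h * R - J\<bar> \<le> 2 * h" for v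
      unfolding J_def by (rule gaussian_sum_1) (use h px in auto)
    then obtain R where R: "\<And>v. ((\<lambda>k::int. exp (- (B x x * (h * of_int k + sh v)\<^sup>2 / 2))) has_sum R v) UNIV"
      "\<And>v. \<bar>h * R v - J\<bar> \<le> 2 * h" by metis
    have R0: "R v \<ge> 0" for v by (rule has_sum_nonneg[OF R(1)]) auto
    have e0: "e v > 0" for v by (simp add: e_def)
    have S0: "S \<ge> 0" by (rule has_sum_nonneg[OF S(1)]) (use e0 less_imp_le in blast)
    let ?f = "\<lambda>v. exp (- (B (h *\<^sub>R v + t) (h *\<^sub>R v + t) / 2))"
    have f_eq: "?f (of_int k *\<^sub>R x + v) = e v * exp (- (B x x * (h * of_int k + sh v)\<^sup>2 / 2))" for k v
    proof -
      have "h *\<^sub>R (of_int k *\<^sub>R x + v) + t = (h * of_int k + s) *\<^sub>R x + (h *\<^sub>R v + t')"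
        by (simp add: t'_def algebra_simps)
      thus ?thesis
        by (simp add: sch(3) e_def sh_def exp_add[symmetric] add.assoc add_divide_distrib)
    qed
    have inner: "((\<lambda>k. ?f (of_int k *\<^sub>R x + v)) has_sum e v * R v) UNIV" for v
      unfolding f_eq by (rule has_sum_cmult_right[OF R(1)])
    \<comment> \<open>The error \<open>2 * h\<close> is the same for all \<open>v\<close>, so after
      weighting by \<open>e v\<close> the inner sums are trapped between two fixed multiples of
      \<open>e v\<close>, and the outer sum can be compared with \<open>S\<close>.\<close>
    have up: "e v * R v \<le> (J + 2 * h) / h * e v" and lo: "(J - 2 * h) / h * e v \<le> e v * R v" for v
    proof -
      have "e v * (h * R v) \<le> e v * (J + 2 * h)" "e v * (J - 2 * h) \<le> e v * (h * R v)"
        using R(2)[of v] e0[of v] by (auto simp: abs_le_iff)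
      thus "e v * R v \<le> (J + 2 * h) / h * e v" "(J - 2 * h) / h * e v \<le> e v * R v"
        using h by (simp_all add: field_simps)
    qed
    have "(\<lambda>v. e v * R v) summable_on zspan xs"
    proof (rule summable_on_comparison_test[OF _ up])
      show "(\<lambda>v. (J + 2 * h) / h * e v) summable_on zspan xs"
        using has_sum_cmult_right[OF S(1)] by (rule has_sum_imp_summable)
    qed (use less_imp_le[OF e0] R0 in auto)
    then obtain T where T: "((\<lambda>v. e v * R v) has_sum T) (zspan xs)" by (auto simp: summable_on_def)
    have "T \<le> (J + 2 * h) / h * S" "(J - 2 * h) / h * S \<le> T"
      using has_sum_mono[OF T has_sum_cmult_right[OF S(1)] up]
        has_sum_mono[OF has_sum_cmult_right[OF S(1)] T lo] by auto
    hence hT: "\<bar>h * T - J * S\<bar> \<le> 2 * h * S"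
      using h by (simp add: abs_le_iff field_simps)
    let ?F = "\<lambda>(v, k). ?f (of_int k *\<^sub>R x + v)"
    have "(?F has_sum T) (zspan xs \<times> UNIV)"
    proof (rule has_sum_SigmaI[OF _ T])
      show "((\<lambda>k. ?F (v, k)) has_sum e v * R v) UNIV" for v using inner[of v] by simp
      show "?F summable_on zspan xs \<times> UNIV"
        by (rule summable_on_SigmaI[OF _ has_sum_imp_summable[OF T]]) (use inner in auto)
    qed
    hence "(?f has_sum T) (zspan (x # xs))"
      using zspan_Cons_inj[of x xs] Cons.prems(3,4)
      by (simp add: has_sum_reindex o_def case_prod_unfold)
    moreover have "\<bar>h ^ length (x # xs) * T - J * I\<bar> \<le> (2 * (I + C) + J * C) * h"
    proof -
      \<comment> \<open>The first part is the error of the inner sums, the second that of the outer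
        one. The bound \<open>h \<le> 1\<close> keeps \<open>h ^ ?n * S\<close> below
        \<open>I + C\<close>.\<close>
      have "h ^ length (x # xs) * T - J * I = h ^ ?n * (h * T - J * S) + J * (h ^ ?n * S - I)"
        by (simp add: algebra_simps)
      also have "\<bar>\<dots>\<bar> \<le> h ^ ?n * (2 * h * S) + J * (C * h)"
      proof (rule order_trans[OF abs_triangle_ineq], rule add_mono)
        show "\<bar>h ^ ?n * (h * T - J * S)\<bar> \<le> h ^ ?n * (2 * h * S)"
          using hT h by (simp add: abs_mult)
        show "\<bar>J * (h ^ ?n * S - I)\<bar> \<le> J * (C * h)"
          using S(2) IJ by (simp add: abs_mult mult_left_mono)
      qed
      also have "h ^ ?n * (2 * h * S) = 2 * h * (h ^ ?n * S)" by simp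
      also have "\<dots> \<le> 2 * h * (I + C)"
      proof (rule mult_left_mono)
        have "C * h \<le> C" using C(1) h by (simp add: mult_left_le)
        thus "h ^ ?n * S \<le> I + C" using S(2) by (simp add: abs_le_iff)
      qed (use h in simp)
      finally show ?thesis by (simp add: algebra_simps)
    qed
    ultimately show "\<exists>S. (?f has_sum S) (zspan (x # xs)) \<and>
      \<bar>h ^ length (x # xs) * S - sqrt ((2 * pi) ^ length (x # xs) / gram_det B (x # xs))\<bar>
        \<le> (2 * (I + C) + J * C) * h"
      unfolding IJ_eq by blast
  qed
qed

lemma powr_half_of_nat:
  assumes "x > 0"
  shows "x powr (real k / 2) = sqrt (x ^ k)"
  using assms by (simp add: powr_half_sqrt[symmetric] powr_realpow[symmetric] powr_powr)

text \<open>The factor \<open>c\<close> is absorbed into the form, and the mesh is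
  \<open>1 / sqrt n\<close>. Nothing is assumed on how \<open>t n\<close> varies with
  \<open>n\<close>, since the error bound is independent of the shift.\<close>

lemma gaussian_lattice_limit:
  fixes B :: "'a::real_vector \<Rightarrow> 'a \<Rightarrow> real" and t :: "nat \<Rightarrow> 'a"
  assumes B: "bilinear B" and sym: "\<And>u v. B u v = B v u"
    and xs: "distinct xs" "independent (set xs)"
    and pos: "\<And>v. v \<in> span (set xs) \<Longrightarrow> v \<noteq> 0 \<Longrightarrow> B v v > 0"
    and t: "\<And>n. n > 0 \<Longrightarrow> t n \<in> span (set xs)" and c: "c > 0"
  defines "q \<equiv> \<lambda>n v. real n * B ((1 / real n) *\<^sub>R v + t n) ((1 / real n) *\<^sub>R v + t n) / 2"
  shows "n > 0 \<Longrightarrow> (\<lambda>v. exp (- (c * q n v))) summable_on zspan xs"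
    and "(\<lambda>n. infsum (\<lambda>v. exp (- (c * q n v))) (zspan xs) / real n powr (real (length xs) / 2))
           \<longlonglongrightarrow> sqrt ((2 * pi) ^ length xs / (c ^ length xs * gram_det B xs))"
proof -
  note lin = bilinear_ladd[OF B] bilinear_radd[OF B] bilinear_lmul[OF B] bilinear_rmul[OF B]
  let ?r = "length xs" and ?B = "\<lambda>u v. c * B u v"
  let ?I = "sqrt ((2 * pi) ^ ?r / (c ^ ?r * gram_det B xs))"
  have "bilinear ?B"
    unfolding bilinear_def by (auto intro!: linearI simp: lin algebra_simps)
  moreover have "?B u v = ?B v u" for u v using sym[of u v] by simp
  ultimately obtain C where C: "\<And>h t. 0 < h \<Longrightarrow> h \<le> 1 \<Longrightarrow> t \<in> span (set xs) \<Longrightarrow>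
      \<exists>S. ((\<lambda>v. exp (- (?B (h *\<^sub>R v + t) (h *\<^sub>R v + t) / 2))) has_sum S) (zspan xs) \<and>
        \<bar>h ^ ?r * S - ?I\<bar> \<le> C * h"
    using gaussian_lattice_sum[of ?B xs] xs pos c unfolding gram_det_cmult by fastforce
  have main: "(\<lambda>v. exp (- (c * q n v))) summable_on zspan xs"
    "\<bar>infsum (\<lambda>v. exp (- (c * q n v))) (zspan xs) / real n powr (real ?r / 2) - ?I\<bar> \<le> C * (1 / sqrt (real n))"
    if n: "n > 0" for n
  proof -
    \<comment> \<open>With this mesh and the shift \<open>sqrt n *\<^sub>R t n\<close> the argument
      is \<open>sqrt n\<close> times \<open>(1 / n) *\<^sub>R v + t n\<close>, which produces the
      factor \<open>n\<close> in \<open>q\<close>.\<close>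
    define h where "h = 1 / sqrt (real n)"
    have h: "0 < h" "h \<le> 1" using n by (auto simp: h_def)
    have "exp (- (?B (h *\<^sub>R v + sqrt (real n) *\<^sub>R t n) (h *\<^sub>R v + sqrt (real n) *\<^sub>R t n) / 2)) = exp (- (c * q n v))" for v
    proof -
      have "h *\<^sub>R v + sqrt (real n) *\<^sub>R t n = sqrt (real n) *\<^sub>R ((1 / real n) *\<^sub>R v + t n)"
        using n by (simp add: h_def scaleR_add_right real_div_sqrt field_simps)
      moreover have "B (sqrt (real n) *\<^sub>R y) (sqrt (real n) *\<^sub>R y) = real n * B y y" for y
        using n by (simp add: bilinear_lmul[OF B] bilinear_rmul[OF B] mult.assoc[symmetric])
      ultimately show ?thesis by (simp add: q_def)
    qed
    with C[OF h, of "sqrt (real n) *\<^sub>R t n"] t[OF n]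
    obtain S where S: "((\<lambda>v. exp (- (c * q n v))) has_sum S) (zspan xs)" "\<bar>h ^ ?r * S - ?I\<bar> \<le> C * h"
      by (auto simp: span_scale)
    have "real n powr (real ?r / 2) = sqrt (real n) ^ ?r"
      using n by (simp add: powr_half_of_nat real_sqrt_power)
    hence "h ^ ?r * S = S / real n powr (real ?r / 2)"
      by (simp add: h_def power_divide)
    with S show "(\<lambda>v. exp (- (c * q n v))) summable_on zspan xs"
      "\<bar>infsum (\<lambda>v. exp (- (c * q n v))) (zspan xs) / real n powr (real ?r / 2) - ?I\<bar> \<le> C * (1 / sqrt (real n))"
      by (auto simp: has_sum_iff h_def)
  qed
  show "n > 0 \<Longrightarrow> (\<lambda>v. exp (- (c * q n v))) summable_on zspan xs" using main(1) .
  have "(\<lambda>n. C * (1 / sqrt (real n))) \<longlonglongrightarrow> 0" by real_asymp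
  moreover have "\<forall>\<^sub>F n in sequentially. norm (infsum (\<lambda>v. exp (- (c * q n v))) (zspan xs) / real n powr (real ?r / 2) - ?I)
      \<le> C * (1 / sqrt (real n))"
    using eventually_gt_at_top[of 0] by eventually_elim (use main(2) in simp)
  ultimately have "(\<lambda>n. infsum (\<lambda>v. exp (- (c * q n v))) (zspan xs) / real n powr (real ?r / 2) - ?I) \<longlonglongrightarrow> 0"
    by (rule Lim_null_comparison[rotated])
  thus "(\<lambda>n. infsum (\<lambda>v. exp (- (c * q n v))) (zspan xs) / real n powr (real ?r / 2)) \<longlonglongrightarrow> ?I"
    by (rule LIM_zero_cancel)
qed

text \<open>In the hypothesis on \<open>F\<close>, the first two error terms account for the points near the maximum
  and the last one for all other points.\<close>

lemma laplace_lattice_sum: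
  fixes B :: "'a::real_vector \<Rightarrow> 'a \<Rightarrow> real" and t :: "nat \<Rightarrow> 'a" and F :: "nat \<Rightarrow> 'a \<Rightarrow> real"
  assumes B: "bilinear B" and sym: "\<And>u v. B u v = B v u"
    and xs: "distinct xs" "independent (set xs)"
    and pos: "\<And>v. v \<in> span (set xs) \<Longrightarrow> v \<noteq> 0 \<Longrightarrow> B v v > 0"
    and t: "\<And>n. n > 0 \<Longrightarrow> t n \<in> span (set xs)"
  defines "q \<equiv> \<lambda>n v. real n * B ((1 / real n) *\<^sub>R v + t n) ((1 / real n) *\<^sub>R v + t n) / 2"
  assumes approx: "\<And>\<eta>. 0 < \<eta> \<Longrightarrow> \<eta> < 1 \<Longrightarrow> \<exists>C \<kappa> \<tau>. \<kappa> > 0 \<and> \<tau> > 0 \<and>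
      (\<forall>\<^sub>F n in sequentially. \<forall>v\<in>zspan xs. \<bar>F n v - p * exp (- q n v)\<bar> \<le>
          \<eta> * exp (- ((1 - \<eta>) * q n v))
          + p * (exp (- ((1 - \<eta>) * q n v)) - exp (- ((1 + \<eta>) * q n v)))
          + C * exp (- \<kappa> * real n) * exp (- (\<tau> * q n v)))"
  shows "(\<lambda>n. infsum (F n) (zspan xs) / real n powr (real (length xs) / 2))
           \<longlonglongrightarrow> p * sqrt ((2 * pi) ^ length xs / gram_det B xs)"
proof -
  let ?r = "length xs" and ?Z = "zspan xs"
  define A where "A = (\<lambda>c n. infsum (\<lambda>v. exp (- (c * q n v))) ?Z / real n powr (real ?r / 2))"
  define I where "I = (\<lambda>c. sqrt ((2 * pi) ^ ?r / (c ^ ?r * gram_det B xs)))"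
  have gpos: "gram_det B xs > 0" by (rule gram_det_pos[OF B sym xs pos])
  have summ: "(\<lambda>v. exp (- (c * q n v))) summable_on ?Z" if "c > 0" "n > 0" for c n
    unfolding q_def by (rule gaussian_lattice_limit(1)[OF B sym xs pos t that(1) that(2)])
  have lim: "A c \<longlonglongrightarrow> I c" if "c > 0" for c
    unfolding A_def I_def q_def by (rule gaussian_lattice_limit(2)[OF B sym xs pos t that])
  define X where "X = (\<lambda>n. infsum (F n) ?Z / real n powr (real ?r / 2) - p * A 1 n)"
  \<comment> \<open>The limit of the summed error bound for fixed \<eta>; the exponentially small
    term has dropped out. It tends to 0 with \<eta> because \<open>I\<close> is continuous at
    1.\<close>
  define M where "M = (\<lambda>\<eta>. \<eta> * I (1 - \<eta>) + p * (I (1 - \<eta>) - I (1 + \<eta>)))"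
  have M0: "(M \<longlongrightarrow> 0) (at_right 0)"
  proof -
    have "isCont I 1" unfolding I_def using gpos by (auto intro!: continuous_intros)
    have "((\<lambda>\<eta>. I (1 - \<eta>)) \<longlongrightarrow> I 1) (at_right 0)"
      by (rule isCont_tendsto_compose[OF \<open>isCont I 1\<close>]) (auto intro!: tendsto_eq_intros)
    moreover have "((\<lambda>\<eta>. I (1 + \<eta>)) \<longlongrightarrow> I 1) (at_right 0)"
      by (rule isCont_tendsto_compose[OF \<open>isCont I 1\<close>]) (auto intro!: tendsto_eq_intros)
    ultimately have "(M \<longlongrightarrow> 0 * I 1 + p * (I 1 - I 1)) (at_right 0)"
      unfolding M_def by (intro tendsto_intros)
    thus ?thesis by simp
  qed
  have "X \<longlonglongrightarrow> 0"
  proof (rule tendstoI)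
    fix e :: real assume e: "e > 0"
    have "\<forall>\<^sub>F \<eta> in at_right 0. M \<eta> < e" using order_tendstoD(2)[OF M0] e by blast
    moreover have "\<forall>\<^sub>F \<eta> in at_right 0. \<eta> \<in> {0<..<1::real}" by (rule eventually_at_right_real) simp
    ultimately have "\<forall>\<^sub>F \<eta> in at_right 0. M \<eta> < e \<and> \<eta> \<in> {0<..<1::real}" by (rule eventually_conj)
    then obtain \<eta> where \<eta>: "M \<eta> < e" "0 < \<eta>" "\<eta> < 1"
      using eventually_happens[of _ "at_right (0::real)"] by auto
    obtain C \<kappa> \<tau> where \<kappa>: "\<kappa> > 0" "\<tau> > 0" and
      ev: "\<forall>\<^sub>F n in sequentially. \<forall>v\<in>?Z. \<bar>F n v - p * exp (- q n v)\<bar> \<le>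
          \<eta> * exp (- ((1 - \<eta>) * q n v))
          + p * (exp (- ((1 - \<eta>) * q n v)) - exp (- ((1 + \<eta>) * q n v)))
          + C * exp (- \<kappa> * real n) * exp (- (\<tau> * q n v))"
      using approx[OF \<eta>(2,3)] by blast
    define E where "E = (\<lambda>n. \<eta> * A (1 - \<eta>) n + p * (A (1 - \<eta>) n - A (1 + \<eta>) n)
        + C * exp (- \<kappa> * real n) * A \<tau> n)"
    have "(\<lambda>n. exp (- \<kappa> * real n)) \<longlonglongrightarrow> 0" using \<kappa> by real_asymp
    hence "E \<longlonglongrightarrow> \<eta> * I (1 - \<eta>) + p * (I (1 - \<eta>) - I (1 + \<eta>)) + C * 0 * I \<tau>"
      unfolding E_def using \<eta> \<kappa> by (intro tendsto_intros lim) auto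
    hence "E \<longlonglongrightarrow> M \<eta>" by (simp add: M_def)
    hence "\<forall>\<^sub>F n in sequentially. E n < e" using \<eta>(1) by (rule order_tendstoD(2))
    with ev eventually_gt_at_top[of 0] show "\<forall>\<^sub>F n in sequentially. dist (X n) 0 < e"
    proof eventually_elim
      case (elim n)
      define D where "D = (\<lambda>v. F n v - p * exp (- q n v))"
      define G where "G = (\<lambda>v. \<eta> * exp (- ((1 - \<eta>) * q n v))
          + p * (exp (- ((1 - \<eta>) * q n v)) - exp (- ((1 + \<eta>) * q n v)))
          + C * exp (- \<kappa> * real n) * exp (- (\<tau> * q n v)))"
      have DG: "norm (D v) \<le> G v" if "v \<in> ?Z" for v using elim(1) that by (simp add: D_def G_def)
      note hs = has_sum_infsum[OF summ[OF _ elim(2)]]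
      let ?T = "\<lambda>c. infsum (\<lambda>v. exp (- (c * q n v))) ?Z"
      have G: "(G has_sum \<eta> * ?T (1 - \<eta>) + p * (?T (1 - \<eta>) - ?T (1 + \<eta>))
          + C * exp (- \<kappa> * real n) * ?T \<tau>) ?Z"
        unfolding G_def diff_conv_add_uminus using \<eta> \<kappa>
        by (intro has_sum_add has_sum_cmult_right has_sum_uminusI hs) auto
      \<comment> \<open>Without summability \<open>infsum\<close> would take its default value 0, so
        it is first derived from the majorant \<open>G\<close>.\<close>
      have "D summable_on ?Z"
        using Infinite_Sum.abs_summable_on_comparison_test'[OF has_sum_imp_summable[OF G] DG]
        by (rule Infinite_Sum.abs_summable_summable)
      then obtain S where S: "(D has_sum S) ?Z" by (auto simp: summable_on_def)
      have "((\<lambda>v. D v + p * exp (- (1 * q n v))) has_sum S + p * ?T 1) ?Z"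
        by (intro has_sum_add S has_sum_cmult_right hs) auto
      hence "infsum (F n) ?Z = S + p * ?T 1" by (simp add: D_def has_sum_iff)
      hence X: "X n = S / real n powr (real ?r / 2)"
        by (simp add: X_def A_def add_divide_distrib)
      have "norm S \<le> \<eta> * ?T (1 - \<eta>) + p * (?T (1 - \<eta>) - ?T (1 + \<eta>)) + C * exp (- \<kappa> * real n) * ?T \<tau>"
        by (rule norm_infsum_le[OF S G DG])
      hence "\<bar>X n\<bar> \<le> (\<eta> * ?T (1 - \<eta>) + p * (?T (1 - \<eta>) - ?T (1 + \<eta>)) + C * exp (- \<kappa> * real n) * ?T \<tau>)
          / real n powr (real ?r / 2)"
        unfolding X by (simp add: divide_right_mono)
      also have "\<dots> = E n"
        by (simp add: E_def A_def add_divide_distrib diff_divide_distrib right_diff_distrib)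
      finally show ?case using elim(3) by simp
    qed
  qed
  from tendsto_add[OF this tendsto_mult_left[OF lim[of 1], of p]] show ?thesis
    by (simp add: X_def I_def)
qed

section \<open>Second-order conditions at a maximum\<close>

text \<open>Replaces the nested \<open>frechet_derivative\<close> of \<open>hessian\<close> by the
  second derivative from \<open>C2_on\<close>; the last clause is differentiability of the first
  derivative at \<open>x\<^sub>0\<close>, evaluated in a direction \<open>u\<close>.\<close>

lemma C2_on_second_order:
  fixes f :: "'a::euclidean_space \<Rightarrow> real"
  assumes U: "open U" "x\<^sub>0 \<in> U" and C2: "C2_on U f"
  obtains D :: "'a \<Rightarrow> 'a \<Rightarrow>\<^sub>L real" and r where
    "r > 0" "\<And>y. norm (y - x\<^sub>0) < r \<Longrightarrow> (f has_derivative D y) (at y)"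
    "bilinear (hessian f x\<^sub>0)"
    "\<And>e. e > 0 \<Longrightarrow> \<exists>d>0. \<forall>w u. norm w < d \<longrightarrow>
        \<bar>D (x\<^sub>0 + w) u - D x\<^sub>0 u - hessian f x\<^sub>0 w u\<bar> \<le> e * norm w * norm u"
proof -
  obtain D :: "'a \<Rightarrow> 'a \<Rightarrow>\<^sub>L real" and D2 :: "'a \<Rightarrow> 'a \<Rightarrow>\<^sub>L 'a \<Rightarrow>\<^sub>L real"
    where D: "\<And>x. x \<in> U \<Longrightarrow> (f has_derivative D x) (at x)"
      and D2: "\<And>x. x \<in> U \<Longrightarrow> (D has_derivative D2 x) (at x)"
    using C2 unfolding C2_on_def by blast
  have hess: "hessian f x\<^sub>0 u v = D2 x\<^sub>0 u v" for u v
  proof -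
    have "((\<lambda>y. D y v) has_derivative (\<lambda>u. D2 x\<^sub>0 u v)) (at x\<^sub>0)"
      by (rule bounded_linear.has_derivative[OF blinfun.bounded_linear_left D2[OF U(2)]])
    hence "((\<lambda>y. frechet_derivative f (at y) v) has_derivative (\<lambda>u. D2 x\<^sub>0 u v)) (at x\<^sub>0)"
    proof (rule has_derivative_transform_within_open[OF _ U])
      fix y assume "y \<in> U"
      thus "D y v = frechet_derivative f (at y) v"
        by (simp add: frechet_derivative_at[OF D, symmetric])
    qed
    thus ?thesis by (simp add: hessian_def frechet_derivative_at[symmetric])
  qed
  obtain r where r: "r > 0" "ball x\<^sub>0 r \<subseteq> U" using U openE by blast
  show ?thesis
  proof (rule that[OF r(1), of D])
    show "(f has_derivative D y) (at y)" if "norm (y - x\<^sub>0) < r" for y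
      using that r(2) by (intro D) (auto simp: dist_norm norm_minus_commute)
    show "bilinear (hessian f x\<^sub>0)"
      unfolding bilinear_def by (auto intro!: linearI simp: hess blinfun.bilinear_simps)
    fix e :: real assume e: "e > 0"
    from D2[OF U(2)] e obtain d where d: "d > 0" and
      "\<And>y. norm (y - x\<^sub>0) < d \<Longrightarrow> norm (D y - D x\<^sub>0 - D2 x\<^sub>0 (y - x\<^sub>0)) \<le> e * norm (y - x\<^sub>0)"
      unfolding has_derivative_at_alt by metis
    hence *: "norm (D (x\<^sub>0 + w) - D x\<^sub>0 - D2 x\<^sub>0 w) \<le> e * norm w" if "norm w < d" for w
      using that by (metis add_diff_cancel_left')
    have "\<bar>D (x\<^sub>0 + w) u - D x\<^sub>0 u - hessian f x\<^sub>0 w u\<bar> \<le> e * norm w * norm u"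
      if "norm w < d" for w u
    proof -
      have "\<bar>(D (x\<^sub>0 + w) - D x\<^sub>0 - D2 x\<^sub>0 w) u\<bar> \<le> norm (D (x\<^sub>0 + w) - D x\<^sub>0 - D2 x\<^sub>0 w) * norm u"
        using norm_blinfun[of "D (x\<^sub>0 + w) - D x\<^sub>0 - D2 x\<^sub>0 w" u] by simp
      also have "\<dots> \<le> e * norm w * norm u" using *[OF that] by (rule mult_right_mono) simp
      finally show ?thesis by (simp add: hess blinfun.bilinear_simps)
    qed
    thus "\<exists>d>0. \<forall>w u. norm w < d \<longrightarrow>
        \<bar>D (x\<^sub>0 + w) u - D x\<^sub>0 u - hessian f x\<^sub>0 w u\<bar> \<le> e * norm w * norm u"
      using d by blast
  qed
qed

lemma has_real_derivative_along_line:
  fixes f :: "'a::real_normed_vector \<Rightarrow> real"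
  assumes "(f has_derivative f') (at (y + s *\<^sub>R u))"
  shows "((\<lambda>s. f (y + s *\<^sub>R u)) has_real_derivative f' u) (at s)"
proof -
  have "((\<lambda>s. y + s *\<^sub>R u) has_derivative (\<lambda>c. c *\<^sub>R u)) (at s)"
    by (auto intro!: derivative_eq_intros)
  from has_derivative_compose[OF this assms]
  have "((\<lambda>s. f (y + s *\<^sub>R u)) has_derivative (\<lambda>c. f' (c *\<^sub>R u))) (at s)" .
  moreover have "f' (c *\<^sub>R u) = f' u * c" for c
    using linear_scale[OF has_derivative_linear[OF assms]] by simp
  ultimately show ?thesis by (simp add: has_field_derivative_def)
qed

text \<open>The second difference at \<open>x\<^sub>0\<close> is symmetric in the two directions, and it is
  \<open>s\<^sup>2\<close> times either mixed second derivative up to \<open>o(s\<^sup>2)\<close>.\<close>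

lemma hessian_symmetric:
  fixes f :: "'a::euclidean_space \<Rightarrow> real"
  assumes U: "open U" "x\<^sub>0 \<in> U" and C2: "C2_on U f"
  shows "hessian f x\<^sub>0 u v = hessian f x\<^sub>0 v u"
proof -
  obtain r and D :: "'a \<Rightarrow> 'a \<Rightarrow>\<^sub>L real" where r: "r > 0"
    and D: "\<And>y. norm (y - x\<^sub>0) < r \<Longrightarrow> (f has_derivative D y) (at y)"
    and bil: "bilinear (hessian f x\<^sub>0)"
    and tay: "\<And>e. e > 0 \<Longrightarrow> \<exists>d>0. \<forall>w u. norm w < d \<longrightarrow>
        \<bar>D (x\<^sub>0 + w) u - D x\<^sub>0 u - hessian f x\<^sub>0 w u\<bar> \<le> e * norm w * norm u"
    by (rule C2_on_second_order[OF U C2]) (rule that)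
  note lin = bilinear_ladd[OF bil] bilinear_radd[OF bil] bilinear_lmul[OF bil] bilinear_rmul[OF bil]
  define N where "N = norm u + norm v + 1"
  have N: "N > 0" "norm u + norm v \<le> N" by (auto simp: N_def add_nonneg_pos)
  define \<Delta> where "\<Delta> = (\<lambda>s. f (x\<^sub>0 + s *\<^sub>R u + s *\<^sub>R v) - f (x\<^sub>0 + s *\<^sub>R u) - f (x\<^sub>0 + s *\<^sub>R v) + f x\<^sub>0)"
  \<comment> \<open>Stated for all pairs \<open>u\<close>, \<open>v\<close>, so that it can be
    applied a second time with the two directions exchanged.\<close>
  have step: "\<bar>f (x\<^sub>0 + s *\<^sub>R u + s *\<^sub>R v) - f (x\<^sub>0 + s *\<^sub>R u) - f (x\<^sub>0 + s *\<^sub>R v) + f x\<^sub>0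
      - s\<^sup>2 * hessian f x\<^sub>0 v u\<bar> \<le> 2 * e * s\<^sup>2 * N\<^sup>2"
    if s: "s > 0" "s * N < d" "s * N < r" and uv: "norm u + norm v \<le> N" and e: "e > 0"
    and d: "\<And>w u. norm w < d \<Longrightarrow>
        \<bar>D (x\<^sub>0 + w) u - D x\<^sub>0 u - hessian f x\<^sub>0 w u\<bar> \<le> e * norm w * norm u"
    for s e d u v
  proof -
    \<comment> \<open>The second difference is \<open>g 1 - g 0\<close>; the mean value theorem in
      direction \<open>u\<close> leaves a difference of first derivatives at points displaced by
      \<open>s *\<^sub>R v\<close>.\<close>
    define g where "g = (\<lambda>\<tau>. f ((x\<^sub>0 + s *\<^sub>R v) + \<tau> *\<^sub>R (s *\<^sub>R u)) - f (x\<^sub>0 + \<tau> *\<^sub>R (s *\<^sub>R u)))"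
    define w1 where "w1 = (\<lambda>\<tau>. s *\<^sub>R v + \<tau> *\<^sub>R (s *\<^sub>R u))"
    define w2 where "w2 = (\<lambda>\<tau>. \<tau> *\<^sub>R (s *\<^sub>R u))"
    have bd: "norm (w1 \<tau>) \<le> s * N" "norm (w2 \<tau>) \<le> s * N" if "0 \<le> \<tau>" "\<tau> \<le> 1" for \<tau>
    proof -
      have tu: "norm (\<tau> *\<^sub>R (s *\<^sub>R u)) \<le> s * norm u"
        using that s mult_right_mono[of \<tau> 1 "s * norm u"] by simp
      have "norm (w1 \<tau>) \<le> s * norm v + s * norm u"
        unfolding w1_def using s by (intro norm_triangle_le add_mono tu) auto
      also have "\<dots> \<le> s * N" using uv s by (simp add: distrib_left[symmetric] add.commute)
      finally show "norm (w1 \<tau>) \<le> s * N" .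
      have "norm u \<le> N" using uv norm_ge_zero[of v] by linarith
      thus "norm (w2 \<tau>) \<le> s * N"
        unfolding w2_def using s by (intro order_trans[OF tu] mult_left_mono) auto
    qed
    have "\<exists>z. 0 < z \<and> z < 1 \<and> g 1 - g 0 = (1 - 0) * (D (x\<^sub>0 + w1 z) (s *\<^sub>R u) - D (x\<^sub>0 + w2 z) (s *\<^sub>R u))"
    proof (rule MVT2)
      fix \<tau> :: real assume "0 \<le> \<tau>" "\<tau> \<le> 1"
      from bd[OF this] s(3)
      show "(g has_real_derivative D (x\<^sub>0 + w1 \<tau>) (s *\<^sub>R u) - D (x\<^sub>0 + w2 \<tau>) (s *\<^sub>R u)) (at \<tau>)"
        unfolding g_def w1_def w2_def add.assoc[symmetric]
        by (intro DERIV_diff has_real_derivative_along_line D) (auto simp: algebra_simps)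
    qed simp
    then obtain z where z: "0 < z" "z < 1"
      "g 1 - g 0 = D (x\<^sub>0 + w1 z) (s *\<^sub>R u) - D (x\<^sub>0 + w2 z) (s *\<^sub>R u)" by auto
    let ?E = "\<lambda>w. D (x\<^sub>0 + w) (s *\<^sub>R u) - D x\<^sub>0 (s *\<^sub>R u) - hessian f x\<^sub>0 w (s *\<^sub>R u)"
    have E: "\<bar>?E w\<bar> \<le> e * s\<^sup>2 * N\<^sup>2" if "norm w \<le> s * N" for w
    proof -
      have "\<bar>?E w\<bar> \<le> e * norm w * norm (s *\<^sub>R u)" using that s by (intro d) auto
      also have "\<dots> \<le> e * (s * N) * (s * N)"
      proof (intro mult_mono mult_left_mono that)
        have "norm u \<le> N" using uv norm_ge_zero[of v] by linarith
        thus "norm (s *\<^sub>R u) \<le> s * N" using s by simp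
      qed (use e s N(1) in \<open>auto intro!: mult_nonneg_nonneg\<close>)
      finally show ?thesis by (simp add: power2_eq_square mult_ac)
    qed
    have "hessian f x\<^sub>0 (w1 z) (s *\<^sub>R u) - hessian f x\<^sub>0 (w2 z) (s *\<^sub>R u) = s\<^sup>2 * hessian f x\<^sub>0 v u"
      by (simp add: w1_def w2_def lin power2_eq_square algebra_simps)
    hence "g 1 - g 0 - s\<^sup>2 * hessian f x\<^sub>0 v u = ?E (w1 z) - ?E (w2 z)" using z(3) by simp
    moreover have "f (x\<^sub>0 + s *\<^sub>R u + s *\<^sub>R v) - f (x\<^sub>0 + s *\<^sub>R u) - f (x\<^sub>0 + s *\<^sub>R v) + f x\<^sub>0 = g 1 - g 0"
      by (simp add: g_def algebra_simps)
    ultimately show ?thesis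
      using E[OF bd(1), of z] E[OF bd(2), of z] z by simp
  qed
  have "\<bar>hessian f x\<^sub>0 u v - hessian f x\<^sub>0 v u\<bar> \<le> 0 + e" if e: "e > 0" for e
  proof -
    \<comment> \<open>Each order of the directions costs \<open>2 * e' * N\<^sup>2\<close> after
      division by \<open>s\<^sup>2\<close>; together this is \<open>e\<close>.\<close>
    define e' where "e' = e / (4 * N\<^sup>2)"
    have e': "e' > 0" using e N by (simp add: e'_def)
    obtain d where d: "d > 0" "\<And>w u. norm w < d \<Longrightarrow>
        \<bar>D (x\<^sub>0 + w) u - D x\<^sub>0 u - hessian f x\<^sub>0 w u\<bar> \<le> e' * norm w * norm u"
      using tay[OF e'] by blast
    define s where "s = min d r / (2 * N)"
    have s: "s > 0" "s * N < d" "s * N < r" using d(1) r N by (auto simp: s_def min_def)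
    have "\<bar>\<Delta> s - s\<^sup>2 * hessian f x\<^sub>0 v u\<bar> \<le> 2 * e' * s\<^sup>2 * N\<^sup>2"
      unfolding \<Delta>_def by (rule step[OF s N(2) e' d(2)])
    moreover have "\<bar>\<Delta> s - s\<^sup>2 * hessian f x\<^sub>0 u v\<bar> \<le> 2 * e' * s\<^sup>2 * N\<^sup>2"
      using step[of s d v u e', OF s _ e' d(2)] N(2) unfolding \<Delta>_def by (simp add: algebra_simps)
    ultimately have "\<bar>s\<^sup>2 * (hessian f x\<^sub>0 u v - hessian f x\<^sub>0 v u)\<bar> \<le> s\<^sup>2 * (4 * e' * N\<^sup>2)"
      unfolding abs_le_iff by (simp add: algebra_simps)
    hence "s\<^sup>2 * \<bar>hessian f x\<^sub>0 u v - hessian f x\<^sub>0 v u\<bar> \<le> s\<^sup>2 * (4 * e' * N\<^sup>2)"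
      by (simp add: abs_mult)
    thus ?thesis using s N by (simp add: e'_def)
  qed
  hence "\<bar>hessian f x\<^sub>0 u v - hessian f x\<^sub>0 v u\<bar> \<le> 0" by (rule field_le_epsilon)
  thus ?thesis by simp
qed

text \<open>The mean value theorem is applied along the segment to the remainder after subtracting
  the quadratic polynomial; its derivative is exactly the first-order error of \<open>D\<close> at
  \<open>x\<^sub>0\<close>.\<close>

lemma C2_on_taylor:
  fixes f :: "'a::euclidean_space \<Rightarrow> real"
  assumes U: "open U" "x\<^sub>0 \<in> U" and C2: "C2_on U f"
  obtains D where "linear D" "\<And>e. e > 0 \<Longrightarrow> \<exists>d>0. \<forall>v. norm v < d \<longrightarrow>
      \<bar>f (x\<^sub>0 + v) - f x\<^sub>0 - D v - hessian f x\<^sub>0 v v / 2\<bar> \<le> e * (norm v)\<^sup>2"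
proof -
  obtain r and D :: "'a \<Rightarrow> 'a \<Rightarrow>\<^sub>L real" where r: "r > 0"
    and D: "\<And>y. norm (y - x\<^sub>0) < r \<Longrightarrow> (f has_derivative D y) (at y)"
    and bil: "bilinear (hessian f x\<^sub>0)"
    and tay: "\<And>e. e > 0 \<Longrightarrow> \<exists>d>0. \<forall>w u. norm w < d \<longrightarrow>
        \<bar>D (x\<^sub>0 + w) u - D x\<^sub>0 u - hessian f x\<^sub>0 w u\<bar> \<le> e * norm w * norm u"
    by (rule C2_on_second_order[OF U C2]) (rule that)
  show ?thesis
  proof (rule that)
    show "linear (D x\<^sub>0)" by (rule bounded_linear.linear[OF blinfun.bounded_linear_right])
    fix e :: real assume e: "e > 0"
    obtain d where d: "d > 0" "\<And>w u. norm w < d \<Longrightarrow>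
        \<bar>D (x\<^sub>0 + w) u - D x\<^sub>0 u - hessian f x\<^sub>0 w u\<bar> \<le> e * norm w * norm u"
      using tay[OF e] by blast
    show "\<exists>d>0. \<forall>v. norm v < d \<longrightarrow>
      \<bar>f (x\<^sub>0 + v) - f x\<^sub>0 - D x\<^sub>0 v - hessian f x\<^sub>0 v v / 2\<bar> \<le> e * (norm v)\<^sup>2"
    proof (intro exI[of _ "min d r"] conjI allI impI)
      fix v :: 'a assume v: "norm v < min d r"
      define R where "R = (\<lambda>s. f (x\<^sub>0 + s *\<^sub>R v) - s * D x\<^sub>0 v - s\<^sup>2 * hessian f x\<^sub>0 v v / 2)"
      have sv: "norm (s *\<^sub>R v) \<le> norm v" if "0 \<le> s" "s \<le> 1" for s :: real
        using that mult_right_mono[of s 1 "norm v"] by simp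
      have "\<exists>z. 0 < z \<and> z < 1 \<and>
         R 1 - R 0 = (1 - 0) * (D (x\<^sub>0 + z *\<^sub>R v) v - D x\<^sub>0 v - z * hessian f x\<^sub>0 v v)"
      proof (rule MVT2)
        fix s :: real assume "0 \<le> s" "s \<le> 1"
        hence "((\<lambda>s. f (x\<^sub>0 + s *\<^sub>R v)) has_real_derivative D (x\<^sub>0 + s *\<^sub>R v) v) (at s)"
          using sv[of s] v by (intro has_real_derivative_along_line D) auto
        thus "(R has_real_derivative D (x\<^sub>0 + s *\<^sub>R v) v - D x\<^sub>0 v - s * hessian f x\<^sub>0 v v) (at s)"
          unfolding R_def by (auto intro!: derivative_eq_intros)
      qed simp
      then obtain z where z: "0 < z" "z < 1"
        "R 1 - R 0 = D (x\<^sub>0 + z *\<^sub>R v) v - D x\<^sub>0 v - z * hessian f x\<^sub>0 v v" by auto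
      have "\<bar>D (x\<^sub>0 + z *\<^sub>R v) v - D x\<^sub>0 v - hessian f x\<^sub>0 (z *\<^sub>R v) v\<bar> \<le> e * norm (z *\<^sub>R v) * norm v"
        using sv[of z] z v by (intro d) auto
      also have "\<dots> \<le> e * norm v * norm v"
        using sv[of z] z e by (intro mult_right_mono mult_left_mono) auto
      finally show "\<bar>f (x\<^sub>0 + v) - f x\<^sub>0 - D x\<^sub>0 v - hessian f x\<^sub>0 v v / 2\<bar> \<le> e * (norm v)\<^sup>2"
        using z(3) by (simp add: R_def bilinear_lmul[OF bil] power2_eq_square mult.assoc)
    qed (use d r in auto)
  qed
qed

text \<open>\<open>m\<close> is the minimum of the form on the compact unit sphere of
  \<open>V\<close>; this sphere is empty when \<open>V\<close> is trivial, hence the case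
  distinction.\<close>

lemma bilinear_pos_def_lower_bound:
  fixes B :: "'a::euclidean_space \<Rightarrow> 'a \<Rightarrow> real"
  assumes B: "bilinear B" and V: "subspace V" and pos: "\<And>v. v \<in> V \<Longrightarrow> v \<noteq> 0 \<Longrightarrow> B v v > 0"
  obtains m where "m > 0" "\<And>v. v \<in> V \<Longrightarrow> B v v \<ge> m * (norm v)\<^sup>2"
proof (cases "sphere 0 1 \<inter> V = {}")
  case True
  have "v = 0" if "v \<in> V" for v
  proof (rule ccontr)
    assume "v \<noteq> 0"
    hence "(1 / norm v) *\<^sub>R v \<in> sphere 0 1 \<inter> V" using that V by (simp add: subspace_scale)
    with True show False by blast
  qed
  with that[of 1] show ?thesis using bilinear_lzero[OF B] by fastforce
next
  case False
  have "compact (sphere 0 1 \<inter> V)" using V by (intro compact_Int_closed closed_subspace) auto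
  moreover have "continuous_on (sphere 0 1 \<inter> V) (\<lambda>v. B v v)"
    by (intro bilinear_continuous_on_compose[OF _ _ B] continuous_intros)
  ultimately obtain v0 where v0: "v0 \<in> sphere 0 1 \<inter> V" "\<And>v. v \<in> sphere 0 1 \<inter> V \<Longrightarrow> B v0 v0 \<le> B v v"
    using False continuous_attains_inf[of "sphere 0 1 \<inter> V" "\<lambda>v. B v v"] by blast
  show ?thesis
  proof (rule that)
    show "B v0 v0 > 0" using v0(1) by (intro pos) auto
    fix v assume v: "v \<in> V"
    show "B v0 v0 * (norm v)\<^sup>2 \<le> B v v"
    proof (cases "v = 0")
      case False
      define u where "u = (1 / norm v) *\<^sub>R v"
      have "B v0 v0 \<le> B u u" using v V False by (intro v0(2)) (simp add: u_def subspace_scale)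
      moreover have "v = norm v *\<^sub>R u" using False by (simp add: u_def)
      hence "B v v = (norm v)\<^sup>2 * B u u"
        using bilinear_lmul[OF B, of "norm v" u v] bilinear_rmul[OF B, of u "norm v" u]
        by (metis power2_eq_square mult.assoc real_scaleR_def)
      ultimately show ?thesis by (simp add: mult.commute[of "B v0 v0"] mult_left_mono)
    qed (simp add: bilinear_lzero[OF B])
  qed
qed

text \<open>The expansion at \<open>s *\<^sub>R v\<close> is divided by \<open>s\<close>. Letting
  \<open>s\<close> tend to 0 for \<open>v\<close> and \<open>-v\<close> kills the linear term, and
  what remains bounds the quadratic one.\<close>

lemma second_order_necessary:
  fixes f :: "'a::real_normed_vector \<Rightarrow> real"
  assumes D: "linear D" and Q: "bilinear Q" and V: "subspace V"
    and tay: "\<And>e. e > 0 \<Longrightarrow> \<exists>d>0. \<forall>v. norm v < d \<longrightarrow>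
      \<bar>f (x + v) - f x - D v - Q v v / 2\<bar> \<le> e * (norm v)\<^sup>2"
    and max: "d0 > 0" "\<And>v. v \<in> V \<Longrightarrow> norm v < d0 \<Longrightarrow> f (x + v) \<le> f x"
    and v: "v \<in> V"
  shows "D v = 0" "Q v v \<le> 0"
proof -
  have small: "\<exists>s0>0. \<forall>s. 0 < s \<and> s < s0 \<longrightarrow> D v + s * (Q v v / 2) \<le> s * (e * (norm v)\<^sup>2)"
    if v: "v \<in> V" and e: "e > 0" for v e
  proof -
    obtain d where d: "d > 0" "\<And>v. norm v < d \<Longrightarrow> \<bar>f (x + v) - f x - D v - Q v v / 2\<bar> \<le> e * (norm v)\<^sup>2"
      using tay[OF e] by blast
    show ?thesis
    proof (intro exI[of _ "min d d0 / (norm v + 1)"] conjI allI impI)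
      show "min d d0 / (norm v + 1) > 0" using d(1) max(1) by (simp add: add_nonneg_pos)
      fix s assume s: "0 < s \<and> s < min d d0 / (norm v + 1)"
      have "norm (s *\<^sub>R v) \<le> s * (norm v + 1)" using s by simp
      also have "\<dots> < min d d0" using s by (simp add: pos_less_divide_eq add_nonneg_pos)
      finally have sm: "norm (s *\<^sub>R v) < d" "norm (s *\<^sub>R v) < d0" by auto
      have "f (x + s *\<^sub>R v) \<le> f x" using v V sm by (intro max) (auto simp: subspace_scale)
      moreover have "D (s *\<^sub>R v) = s * D v" using linear_scale[OF D] by simp
      moreover have "Q (s *\<^sub>R v) (s *\<^sub>R v) = s * (s * Q v v)"
        by (simp add: bilinear_lmul[OF Q] bilinear_rmul[OF Q])
      ultimately have "s * D v + s * (s * Q v v) / 2 \<le> e * (norm (s *\<^sub>R v))\<^sup>2"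
        using d(2)[OF sm(1)] by linarith
      hence "s * (D v + s * (Q v v / 2)) \<le> s * (s * (e * (norm v)\<^sup>2))"
        by (simp add: power_mult_distrib power2_eq_square algebra_simps)
      thus "D v + s * (Q v v / 2) \<le> s * (e * (norm v)\<^sup>2)" using s by simp
    qed
  qed
  have le: "D v \<le> 0" if v: "v \<in> V" for v
  proof (rule tendsto_upperbound)
    show "((\<lambda>s. D v + s * (Q v v / 2) - s * (1 * (norm v)\<^sup>2)) \<longlongrightarrow> D v) (at_right 0)"
      by (auto intro!: tendsto_eq_intros)
    obtain s0 where "s0 > 0" "\<And>s. 0 < s \<Longrightarrow> s < s0 \<Longrightarrow> D v + s * (Q v v / 2) \<le> s * (1 * (norm v)\<^sup>2)"
      using small[of v 1] v by auto
    thus "\<forall>\<^sub>F s in at_right 0. D v + s * (Q v v / 2) - s * (1 * (norm v)\<^sup>2) \<le> 0"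
      unfolding eventually_at_right_field by force
  qed simp
  show Dv: "D v = 0"
    using le[OF v] le[of "- v"] v V linear_neg[OF D, of v] by (simp add: subspace_neg)
  show "Q v v \<le> 0"
  proof (rule field_le_epsilon)
    fix e :: real assume e: "e > 0"
    \<comment> \<open>The summand 1 keeps the denominator positive when
      \<open>v = 0\<close>.\<close>
    define e' where "e' = e / (2 * (norm v)\<^sup>2 + 1)"
    have "2 * (norm v)\<^sup>2 + 1 > 0" by (rule add_nonneg_pos) auto
    hence e': "e' > 0" "e' * (2 * (norm v)\<^sup>2) \<le> e"
      using e by (auto simp: e'_def pos_divide_le_eq intro!: mult_left_mono)
    obtain s0 where s0: "s0 > 0" "\<And>s. 0 < s \<Longrightarrow> s < s0 \<Longrightarrow> D v + s * (Q v v / 2) \<le> s * (e' * (norm v)\<^sup>2)"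
      using small[OF v e'(1)] by blast
    from s0(2)[of "s0 / 2"] s0(1) Dv have "s0 / 2 * (Q v v / 2) \<le> s0 / 2 * (e' * (norm v)\<^sup>2)" by simp
    hence "Q v v / 2 \<le> e' * (norm v)\<^sup>2" using s0(1) by simp
    with e'(2) show "Q v v \<le> 0 + e" by simp
  qed
qed

text \<open>Both \<open>exp e\<close> and \<open>exp (- q)\<close> lie between the Gaussians with
  exponents \<open>(1 + \<eta>) * q\<close> and \<open>(1 - \<eta>) * q\<close>, so they differ by
  at most the gap; the amplitude error is charged to the larger Gaussian.\<close>

lemma near_bound:
  fixes e q p c \<eta> :: real
  assumes "\<bar>c - p\<bar> \<le> \<eta>" "\<bar>e + q\<bar> \<le> \<eta> * q" "p \<ge> 0" "\<eta> \<ge> 0" "q \<ge> 0"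
  shows "\<bar>c * exp e - p * exp (- q)\<bar> \<le> \<eta> * exp (- ((1 - \<eta>) * q))
     + p * (exp (- ((1 - \<eta>) * q)) - exp (- ((1 + \<eta>) * q)))"
proof -
  have "\<eta> * q \<ge> 0" using assms by simp
  hence ord: "exp (- ((1 + \<eta>) * q)) \<le> exp e" "exp e \<le> exp (- ((1 - \<eta>) * q))"
    "exp (- ((1 + \<eta>) * q)) \<le> exp (- q)" "exp (- q) \<le> exp (- ((1 - \<eta>) * q))"
    using assms(2) unfolding exp_le_cancel_iff by (auto simp: algebra_simps abs_le_iff)
  have "c * exp e - p * exp (- q) = (c - p) * exp e + p * (exp e - exp (- q))"
    by (simp add: algebra_simps)
  also have "\<bar>\<dots>\<bar> \<le> \<bar>c - p\<bar> * exp e + p * \<bar>exp e - exp (- q)\<bar>"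
    using assms(3) by (intro order_trans[OF abs_triangle_ineq]) (simp add: abs_mult)
  also have "\<bar>exp e - exp (- q)\<bar> \<le> exp (- ((1 - \<eta>) * q)) - exp (- ((1 + \<eta>) * q))"
    using ord by linarith
  also have "\<bar>c - p\<bar> * exp e + p * (exp (- ((1 - \<eta>) * q)) - exp (- ((1 + \<eta>) * q)))
      \<le> \<eta> * exp (- ((1 - \<eta>) * q)) + p * (exp (- ((1 - \<eta>) * q)) - exp (- ((1 + \<eta>) * q)))"
    using assms ord(2) by (intro add_mono mult_mono order_refl) auto
  finally show ?thesis using assms(3) by (simp add: mult_left_mono)
qed

section \<open>The asymptotic formula\<close>

theorem theorem2p3:
  fixes L V W K K\<^sub>1 :: "(real ^ 'N) set"
    and w x\<^sub>0 :: "real ^ 'N"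
    and r :: nat
    and \<phi> \<psi> :: "real ^ 'N \<Rightarrow> real"
    and H :: "real ^ 'N \<Rightarrow> real ^ 'N \<Rightarrow> real"
    and l :: "nat \<Rightarrow> real ^ 'N"
    and b :: "nat \<Rightarrow> real"
    and a :: "nat \<Rightarrow> real ^ 'N \<Rightarrow> real"
  assumes "is_lattice_of_rank L r" and "r \<le> CARD('N)"
    and "V = span L"
    and "W = (\<lambda>v. v + w) ` V"
    and "compact K" and "convex K" and "interior K \<noteq> {}"
    and "continuous_on K \<phi>"
    and "x\<^sub>0 \<in> interior K \<inter> W"
    and "\<forall>x \<in> K \<inter> W. x \<noteq> x\<^sub>0 \<longrightarrow> \<phi> x < \<phi> x\<^sub>0"
    and "\<exists>U. open U \<and> x\<^sub>0 \<in> U \<and> U \<subseteq> K \<and> C2_on U \<phi>"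
    and "H = hessian \<phi> x\<^sub>0"
    and "K\<^sub>1 \<subseteq> K" and "x\<^sub>0 \<in> interior K\<^sub>1"
    and "continuous_on K\<^sub>1 \<psi>" and "\<psi> x\<^sub>0 > 0"
    and "\<forall>n>0. (1 / real n) *\<^sub>R l n \<in> W"
    and "\<forall>n>0. b n > 0"
    and "\<exists>\<epsilon>. unif_smallo (lattice_pts L l K) \<epsilon> (\<lambda>n x. real n) \<and>
             unif_bigo (lattice_pts L l K) a
               (\<lambda>n x. b n * exp (real n * \<phi> ((1 / real n) *\<^sub>R x) + \<epsilon> n x))"
    and "\<exists>\<epsilon>. unif_smallo (lattice_pts L l K\<^sub>1) \<epsilon> (\<lambda>n x. 1) \<and>
             (\<forall>n>0. \<forall>x \<in> lattice_pts L l K\<^sub>1 n.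
                a n x = b n * (\<psi> ((1 / real n) *\<^sub>R x) + \<epsilon> n x)
                          * exp (real n * \<phi> ((1 / real n) *\<^sub>R x)))"
    and "form_det_on (\<lambda>u v. - H u v) V \<noteq> 0"
  shows "(\<lambda>n. \<Sum>x \<in> lattice_pts L l K n. a n x) \<sim>[sequentially]
         (\<lambda>n. (2 * pi) powr (real r / 2) * \<psi> x\<^sub>0
                / (lattice_vol L * sqrt (form_det_on (\<lambda>u v. - H u v) V))
              * b n * real n powr (real r / 2) * exp (real n * \<phi> x\<^sub>0))"
proof -

  \<comment> \<open>Lattice bases as bases of the subspace \<open>V\<close>\<close>
  define xs where "xs = (SOME xs. is_lattice_basis L xs)"
  obtain xs' where xs': "is_lattice_basis L xs'" "length xs' = r"
    using assms(1) by (auto simp: is_lattice_of_rank_def)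
  have xs_basis: "is_lattice_basis L xs" unfolding xs_def using xs'(1) by (rule someI)
  have lat: "distinct ys \<and> independent (set ys) \<and> L = zspan ys \<and> is_basis_list V ys"
    if "is_lattice_basis L ys" for ys
  proof -
    have ys: "distinct ys" "independent (set ys)" "L = zspan ys"
      using that by (auto simp: is_lattice_basis_def zspan_eq)
    have "set ys \<subseteq> zspan ys"
    proof (induction ys)
      case (Cons y ys)
      have "0 \<in> zspan zs" for zs :: "(real ^ 'N) list"
        unfolding zspan_eq by (intro CollectI exI[of _ "\<lambda>_. 0"]) simp
      hence "y \<in> zspan (y # ys)" by (auto intro!: image_eqI[of _ _ "(0, 1)"])
      moreover have "zspan ys \<subseteq> zspan (y # ys)" by (auto intro!: image_eqI[of _ _ "(_, 0)"])
      ultimately show ?case using Cons.IH by auto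
    qed simp
    hence "span (set ys) = span L"
      using zspan_subset_span[of ys] ys(3) by (intro span_eq[THEN iffD2]) (auto intro: span_base)
    with ys show ?thesis by (simp add: is_basis_list_def assms(3))
  qed
  have xs: "distinct xs" "independent (set xs)" and L: "L = zspan xs" and bas: "is_basis_list V xs"
    using lat[OF xs_basis] by auto
  have V: "V = span (set xs)" using bas by (simp add: is_basis_list_def)
  have subV: "subspace V" by (simp add: V)

  \<comment> \<open>Second-order behaviour of \<phi> at the maximum\<close>
  obtain U where U: "open U" "x\<^sub>0 \<in> U" "U \<subseteq> K" "C2_on U \<phi>" using assms(11) by blast
  have H: "H = hessian \<phi> x\<^sub>0" by fact
  have bilH: "bilinear H"
    by (rule C2_on_second_order[OF U(1,2,4)]) (simp add: H)
  have symH: "H u v = H v u" for u v unfolding H by (rule hessian_symmetric[OF U(1,2,4)])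
  obtain D where D: "linear D" and tay: "\<And>e. e > 0 \<Longrightarrow> \<exists>d>0. \<forall>v. norm v < d \<longrightarrow>
      \<bar>\<phi> (x\<^sub>0 + v) - \<phi> x\<^sub>0 - D v - H v v / 2\<bar> \<le> e * (norm v)\<^sup>2"
    using C2_on_taylor[OF U(1,2,4)] unfolding H by metis
  have x0: "x\<^sub>0 \<in> interior K" "x\<^sub>0 \<in> W" using assms(9) by auto
  have inW: "x\<^sub>0 + v \<in> W" if "v \<in> V" for v
    using x0(2) that subV unfolding assms(4) by (auto simp: image_iff subspace_add algebra_simps intro!: bexI[of _ "_ + v"])
  have WV: "x - x\<^sub>0 \<in> V" if "x \<in> W" for x
    using x0(2) that subV unfolding assms(4) by (auto simp: subspace_diff)
  have max: "\<phi> x \<le> \<phi> x\<^sub>0" if "x \<in> K" "x \<in> W" for x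
    using assms(10) that by (cases "x = x\<^sub>0") (auto intro: less_imp_le)
  obtain d0 where d0: "d0 > 0" "ball x\<^sub>0 d0 \<subseteq> K" using x0(1) by (auto simp: mem_interior)
  \<comment> \<open>The maximum is only relative to \<open>W\<close>, so the derivative is shown to
    vanish along \<open>V\<close> and may be nonzero in other directions.\<close>
  have crit: "D v = 0" "H v v \<le> 0" if "v \<in> V" for v
    by (rule second_order_necessary[OF D bilH subV tay d0(1) _ that],
        use d0(2) in \<open>auto intro!: max inW simp: subset_iff dist_norm\<close>)+

  \<comment> \<open>Positive definiteness of the negated Hessian on \<open>V\<close>\<close>
  define B where "B = (\<lambda>u v. - H u v)"
  have bilB: "bilinear B"
    using bilH unfolding B_def bilinear_def by (auto intro: linear_compose_neg)
  have symB: "B u v = B v u" for u v by (simp add: B_def symH)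
  obtain zs where zs: "is_basis_list V zs" "form_det_on B V = gram_det B zs / gram_det inner zs"
    using someI[of "is_basis_list V", OF bas] by (auto simp: form_det_on_def Let_def)
  have fdet: "form_det_on B V = gram_det B xs / gram_det inner xs" and gin: "gram_det inner xs > 0"
    using gram_det_basis_quotient[OF bilB zs(1) bas] zs(2) by auto
  \<comment> \<open>The rank is attached to \<open>xs'\<close>, whereas \<open>xs\<close> is the
    basis chosen in \<open>lattice_vol\<close>; both are bases of \<open>V\<close>.\<close>
  have len: "length xs = r"
    using gram_det_basis_quotient(2)[OF bilB bas, of xs'] lat[OF xs'(1)] xs'(2)
      gram_det_basis_quotient(2)[OF bilB, of V xs xs'] bas by simp
  have "gram_det B xs \<noteq> 0" using assms(21) fdet by (auto simp: B_def)
  have posB: "B v v > 0" if "v \<in> V" "v \<noteq> 0" for v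
    by (rule psd_nondegenerate_pos_def[OF bilB symB _ \<open>gram_det B xs \<noteq> 0\<close>])
      (use that crit(2) in \<open>auto simp: B_def V\<close>)
  have posB': "B v v > 0" if "v \<in> span (set xs)" "v \<noteq> 0" for v using posB that by (simp add: V)
  have gB: "gram_det B xs > 0" by (rule gram_det_pos[OF bilB symB xs posB'])
  obtain m where m: "m > 0" "\<And>v. v \<in> V \<Longrightarrow> B v v \<ge> m * (norm v)\<^sup>2"
    using bilinear_pos_def_lower_bound[OF bilB subV posB] by blast
  have B0: "B v v \<ge> 0" if "v \<in> V" for v using posB[OF that] bilinear_lzero[OF bilB] by (cases "v = 0") force+

  \<comment> \<open>Rescaled coordinates centred at the maximum\<close>
  define t where "t = (\<lambda>n. (1 / real n) *\<^sub>R l n - x\<^sub>0)"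
  have tV: "t n \<in> V" if "n > 0" for n unfolding t_def using assms(17) that by (intro WV) auto
  have tV': "t n \<in> span (set xs)" if "n > 0" for n using tV that by (simp add: V)
  define y where "y = (\<lambda>n v. (1 / real n) *\<^sub>R v + t n)"
  have yV: "y n v \<in> V" if "n > 0" "v \<in> L" for n v
    unfolding y_def using that tV subV assms(3) by (intro subspace_add subspace_scale) (auto intro: span_base)
  have xy: "(1 / real n) *\<^sub>R (v + l n) = x\<^sub>0 + y n v" for n v
    by (simp add: y_def t_def algebra_simps)
  have pts: "v + l n \<in> lattice_pts L l S n \<longleftrightarrow> x\<^sub>0 + y n v \<in> S" if "n > 0" "v \<in> L" for n v S
  proof -
    have "v + l n = real n *\<^sub>R (x\<^sub>0 + y n v)" using that unfolding xy[symmetric] by simp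
    hence "v + l n \<in> (\<lambda>x. real n *\<^sub>R x) ` S \<longleftrightarrow> x\<^sub>0 + y n v \<in> S" using that by auto
    thus ?thesis using that by (simp add: lattice_pts_def)
  qed
  define q where "q = (\<lambda>n v. real n * B (y n v) (y n v) / 2)"
  define p where "p = \<psi> x\<^sub>0"
  \<comment> \<open>Normalised summands, extended by 0 outside \<open>K\<close> so that the sum runs
    over the full lattice.\<close>
  define F where "F = (\<lambda>n v. if x\<^sub>0 + y n v \<in> K then a n (v + l n) / (b n * exp (real n * \<phi> x\<^sub>0)) else 0)"
  obtain M where M: "M > 0" "\<And>u v. norm (B u v) \<le> M * norm u * norm v"
    using bilinear_bounded_pos[OF bilB] by blast
  have "bounded ((\<lambda>x. x - x\<^sub>0) ` K)"
    using assms(5) by (intro bounded_translation_minus compact_imp_bounded)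
  then obtain \<rho> where \<rho>: "\<rho> > 0" "\<And>x. x \<in> K \<Longrightarrow> norm (x - x\<^sub>0) \<le> \<rho>"
    unfolding bounded_pos by auto
  \<comment> \<open>Bounds the form on \<open>K\<close> translated by \<open>-x\<^sub>0\<close>, so
    that \<open>q n v \<le> n * R / 2\<close> there.\<close>
  define R where "R = M * \<rho> * \<rho>"
  have R: "B v v \<le> R" if "x\<^sub>0 + v \<in> K" for v
  proof -
    have "norm v \<le> \<rho>" using \<rho>(2)[OF that] by simp
    hence "M * norm v * norm v \<le> R"
      unfolding R_def using M(1) \<rho>(1) by (intro mult_mono) auto
    with M(2)[of v v] show "B v v \<le> R" by simp
  qed
  have Rpos: "R > 0" using M \<rho> by (simp add: R_def)
  obtain \<epsilon>1 C1 where e1: "unif_smallo (lattice_pts L l K) \<epsilon>1 (\<lambda>n x. real n)" "C1 > 0"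
    "\<forall>\<^sub>F n in sequentially. \<forall>x\<in>lattice_pts L l K n.
       \<bar>a n x\<bar> \<le> C1 * \<bar>b n * exp (real n * \<phi> ((1 / real n) *\<^sub>R x) + \<epsilon>1 n x)\<bar>"
    using assms(19) unfolding unif_bigo_def by blast
  obtain \<epsilon>2 where e2: "unif_smallo (lattice_pts L l K\<^sub>1) \<epsilon>2 (\<lambda>n x. 1)"
    "\<And>n x. n > 0 \<Longrightarrow> x \<in> lattice_pts L l K\<^sub>1 n \<Longrightarrow> a n x = b n * (\<psi> ((1 / real n) *\<^sub>R x) + \<epsilon>2 n x)
                          * exp (real n * \<phi> ((1 / real n) *\<^sub>R x))"
    using assms(20) by blast

  \<comment> \<open>Comparison of the summands with a Gaussian\<close>
  have "(\<lambda>n. infsum (F n) (zspan xs) / real n powr (real (length xs) / 2))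
           \<longlonglongrightarrow> p * sqrt ((2 * pi) ^ length xs / gram_det B xs)"
  proof (rule laplace_lattice_sum[OF bilB symB xs posB' tV'])
    fix \<eta> :: real assume \<eta>: "0 < \<eta>" "\<eta> < 1"
    \<comment> \<open>The precision \<open>\<eta> * m / 2\<close> becomes a relative error \<eta> of
      the exponent, since \<open>m * (norm v)\<^sup>2 \<le> B v v\<close> on
      \<open>V\<close>.\<close>
    obtain d1 where d1: "d1 > 0" "\<And>v. norm v < d1 \<Longrightarrow>
        \<bar>\<phi> (x\<^sub>0 + v) - \<phi> x\<^sub>0 - D v - H v v / 2\<bar> \<le> \<eta> * m / 2 * (norm v)\<^sup>2"
      using tay[of "\<eta> * m / 2"] \<eta> m(1) by auto
    obtain d2 where d2: "d2 > 0" "ball x\<^sub>0 d2 \<subseteq> K\<^sub>1" using assms(14) by (auto simp: mem_interior)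
    have "x\<^sub>0 \<in> K\<^sub>1" using assms(14) interior_subset by blast
    then obtain d3 where d3: "d3 > 0" "\<And>x. x \<in> K\<^sub>1 \<Longrightarrow> dist x x\<^sub>0 < d3 \<Longrightarrow> \<bar>\<psi> x - \<psi> x\<^sub>0\<bar> < \<eta> / 2"
      using assms(15) \<eta>(1) unfolding continuous_on_iff dist_real_def by (metis half_gt_zero)
    define \<delta> where "\<delta> = min d1 (min d2 d3)"
    have \<delta>: "\<delta> > 0" using d1 d2 d3 by (simp add: \<delta>_def)
    define Far where "Far = K \<inter> W \<inter> {x. \<delta> \<le> dist x\<^sub>0 x}"
    \<comment> \<open>Uniqueness of the maximum together with compactness of \<open>Far\<close>
      gives a uniform gap.\<close>
    obtain \<kappa> where \<kappa>: "\<kappa> > 0" "\<And>x. x \<in> Far \<Longrightarrow> \<phi> x \<le> \<phi> x\<^sub>0 - \<kappa>"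
    proof (cases "Far = {}")
      case True
      with that[of 1] show ?thesis by simp
    next
      case False
      have "closed W"
        unfolding assms(4) using closed_translation[OF closed_subspace[OF subV], of w] by (simp add: add.commute)
      moreover have "closed {x. \<delta> \<le> dist x\<^sub>0 x}" by (intro closed_Collect_le continuous_intros)
      ultimately have "compact Far"
        unfolding Far_def using assms(5) by (intro compact_Int_closed) auto
      moreover have "continuous_on Far \<phi>" by (rule continuous_on_subset[OF assms(8)]) (auto simp: Far_def)
      ultimately obtain z where z: "z \<in> Far" "\<And>x. x \<in> Far \<Longrightarrow> \<phi> x \<le> \<phi> z"
        using False continuous_attains_sup by metis
      have "z \<noteq> x\<^sub>0" using z(1) \<delta> by (auto simp: Far_def)
      hence "\<phi> z < \<phi> x\<^sub>0" using z(1) assms(10) by (simp add: Far_def)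
      with that[of "\<phi> x\<^sub>0 - \<phi> z"] z(2) show ?thesis by simp
    qed
    \<comment> \<open>The bound \<open>\<kappa> / (2 * R)\<close> gives
      \<open>\<tau> * q n v \<le> \<kappa> * n / 4\<close> on \<open>K\<close>; the bound 1/2 leaves
      half of \<open>q\<close> to make the comparison Gaussian small far from
      \<open>x\<^sub>0\<close>.\<close>
    define \<tau> where "\<tau> = min (1 / 2) (\<kappa> / (2 * R))"
    have \<tau>: "\<tau> > 0" "\<tau> \<le> 1 / 2" "\<tau> * R \<le> \<kappa> / 2"
    proof -
      have "\<tau> * R \<le> \<kappa> / (2 * R) * R" using Rpos by (intro mult_right_mono) (auto simp: \<tau>_def)
      thus "\<tau> * R \<le> \<kappa> / 2" using Rpos by simp
    qed (use \<kappa> Rpos in \<open>auto simp: \<tau>_def\<close>)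
    \<comment> \<open>Of the gap \<kappa>, one half pays for \<open>\<epsilon>1\<close> and a
      quarter for the weight with \<tau>, leaving a quarter. The other bound is half of
      \<open>q\<close>, which is at least \<open>n * m * \<delta>\<^sup>2 / 4\<close> in the far
      region.\<close>
    define \<kappa>' where "\<kappa>' = min (\<kappa> / 4) (m * \<delta>\<^sup>2 / 4)"
    have \<kappa>': "\<kappa>' > 0" using \<kappa> m \<delta> by (simp add: \<kappa>'_def)
    have "\<forall>\<^sub>F n in sequentially. \<forall>x\<in>lattice_pts L l K n. \<bar>\<epsilon>1 n x\<bar> \<le> \<kappa> / 2 * \<bar>real n\<bar>"
      using e1(1) \<kappa>(1) unfolding unif_smallo_def by (meson half_gt_zero)
    moreover have "\<forall>\<^sub>F n in sequentially. \<forall>x\<in>lattice_pts L l K\<^sub>1 n. \<bar>\<epsilon>2 n x\<bar> \<le> \<eta> / 2 * \<bar>1\<bar>"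
      using e2(1) \<eta>(1) unfolding unif_smallo_def by (meson half_gt_zero)
    \<comment> \<open>In the constant \<open>C1 + p\<close>, the part \<open>C1\<close> covers the
      far summands and \<open>p\<close> the far part of the Gaussian.\<close>
    ultimately have "\<forall>\<^sub>F n in sequentially. \<forall>v\<in>zspan xs. \<bar>F n v - p * exp (- q n v)\<bar> \<le>
          \<eta> * exp (- ((1 - \<eta>) * q n v))
          + p * (exp (- ((1 - \<eta>) * q n v)) - exp (- ((1 + \<eta>) * q n v)))
          + (C1 + p) * exp (- \<kappa>' * real n) * exp (- (\<tau> * q n v))"
      using e1(3) eventually_gt_at_top[of 0]
    proof (eventually_elim, intro ballI)
      fix n v
      assume ev: "\<forall>x\<in>lattice_pts L l K n. \<bar>\<epsilon>1 n x\<bar> \<le> \<kappa> / 2 * \<bar>real n\<bar>"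
        "\<forall>x\<in>lattice_pts L l K\<^sub>1 n. \<bar>\<epsilon>2 n x\<bar> \<le> \<eta> / 2 * \<bar>1\<bar>"
        "\<forall>x\<in>lattice_pts L l K n. \<bar>a n x\<bar> \<le> C1 * \<bar>b n * exp (real n * \<phi> ((1 / real n) *\<^sub>R x) + \<epsilon>1 n x)\<bar>"
        and n: "n > 0" and v: "v \<in> zspan xs"
      have vL: "v \<in> L" using v L by simp
      have bn: "b n > 0" using assms(18) n by blast
      let ?y = "y n v"
      have yv: "?y \<in> V" using yV n vL .
      have q0: "q n v \<ge> 0" using B0[OF yv] by (simp add: q_def)
      have p0: "p > 0" using assms(16) by (simp add: p_def)
      let ?N = "\<eta> * exp (- ((1 - \<eta>) * q n v))
          + p * (exp (- ((1 - \<eta>) * q n v)) - exp (- ((1 + \<eta>) * q n v)))"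
      let ?G = "exp (- \<kappa>' * real n) * exp (- (\<tau> * q n v))"
      show "\<bar>F n v - p * exp (- q n v)\<bar> \<le> ?N + (C1 + p) * exp (- \<kappa>' * real n) * exp (- (\<tau> * q n v))"
      proof (cases "norm ?y < \<delta>")
        case True
        hence K1: "x\<^sub>0 + ?y \<in> K\<^sub>1" using d2(2) by (auto simp: \<delta>_def dist_norm subset_iff)
        hence K: "x\<^sub>0 + ?y \<in> K" using assms(13) by blast
        have mem: "v + l n \<in> lattice_pts L l K\<^sub>1 n" using pts[OF n vL] K1 by simp
        define c where "c = \<psi> (x\<^sub>0 + ?y) + \<epsilon>2 n (v + l n)"
        define e where "e = real n * (\<phi> (x\<^sub>0 + ?y) - \<phi> x\<^sub>0)"
        have "F n v = c * exp e"
          using e2(2)[OF n mem] K bn unfolding xy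
          by (simp add: F_def c_def e_def exp_diff right_diff_distrib)
        moreover have "\<bar>c * exp e - p * exp (- q n v)\<bar> \<le> ?N"
        proof (rule near_bound)
          have "\<bar>\<psi> (x\<^sub>0 + ?y) - p\<bar> < \<eta> / 2"
            unfolding p_def using True K1 by (intro d3(2)) (auto simp: \<delta>_def dist_norm)
          moreover have "\<bar>\<epsilon>2 n (v + l n)\<bar> \<le> \<eta> / 2" using ev(2) mem by auto
          ultimately show "\<bar>c - p\<bar> \<le> \<eta>" unfolding c_def by linarith
          have "\<bar>\<phi> (x\<^sub>0 + ?y) - \<phi> x\<^sub>0 + B ?y ?y / 2\<bar> \<le> \<eta> * m / 2 * (norm ?y)\<^sup>2"
            using d1(2)[of ?y] True crit(1)[OF yv] by (simp add: \<delta>_def B_def)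
          also have "\<dots> \<le> \<eta> * (B ?y ?y / 2)"
            using mult_left_mono[OF m(2)[OF yv], of "\<eta> / 2"] \<eta> by simp
          finally have "real n * \<bar>\<phi> (x\<^sub>0 + ?y) - \<phi> x\<^sub>0 + B ?y ?y / 2\<bar> \<le> real n * (\<eta> * (B ?y ?y / 2))"
            by (rule mult_left_mono) simp
          moreover have "e + q n v = real n * (\<phi> (x\<^sub>0 + ?y) - \<phi> x\<^sub>0 + B ?y ?y / 2)"
            by (simp add: e_def q_def algebra_simps)
          ultimately show "\<bar>e + q n v\<bar> \<le> \<eta> * q n v"
            by (simp add: abs_mult q_def mult_ac)
        qed (use p0 \<eta> q0 in auto)
        moreover have "(C1 + p) * exp (- \<kappa>' * real n) * exp (- (\<tau> * q n v)) \<ge> 0"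
          using e1(2) p0 by simp
        ultimately show ?thesis by linarith
      next
        case False
        hence far: "\<delta> \<le> norm ?y" by simp
        have N0: "?N \<ge> 0"
        proof -
          have "(1 - \<eta>) * q n v \<le> (1 + \<eta>) * q n v" using q0 \<eta> by (intro mult_right_mono) auto
          thus ?thesis using p0 \<eta> by (intro add_nonneg_nonneg mult_nonneg_nonneg) auto
        qed
        have F: "\<bar>F n v\<bar> \<le> C1 * ?G"
        proof (cases "x\<^sub>0 + ?y \<in> K")
          case True
          have mem: "v + l n \<in> lattice_pts L l K n" using pts[OF n vL] True by simp
          have "x\<^sub>0 + ?y \<in> Far" using True far inW[OF yv] by (simp add: Far_def dist_norm)
          hence "real n * (\<phi> (x\<^sub>0 + ?y) - \<phi> x\<^sub>0) \<le> real n * (- \<kappa>)"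
            using \<kappa>(2)[of "x\<^sub>0 + ?y"] by (intro mult_left_mono) auto
          moreover have "\<epsilon>1 n (v + l n) \<le> \<kappa> / 2 * real n" using ev(1) mem by force
          moreover have "\<kappa>' * real n \<le> \<kappa> / 4 * real n" by (intro mult_right_mono) (auto simp: \<kappa>'_def)
          moreover have "\<tau> * q n v \<le> \<kappa> / 4 * real n"
          proof -
            have "\<tau> * B ?y ?y \<le> \<tau> * R" using R[OF True] \<tau>(1) by simp
            also note \<tau>(3)
            finally have "real n / 2 * (\<tau> * B ?y ?y) \<le> real n / 2 * (\<kappa> / 2)" by (intro mult_left_mono) auto
            thus ?thesis by (simp add: q_def mult_ac)
          qed
          ultimately have ex: "real n * (\<phi> (x\<^sub>0 + ?y) - \<phi> x\<^sub>0) + \<epsilon>1 n (v + l n) \<le> - \<kappa>' * real n - \<tau> * q n v"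
            by (simp add: mult.commute[of "real n" \<kappa>])
          have bound: "\<bar>a n (v + l n)\<bar> \<le> C1 * \<bar>b n * exp (real n * \<phi> (x\<^sub>0 + ?y) + \<epsilon>1 n (v + l n))\<bar>"
            using ev(3) mem unfolding xy[symmetric] by blast
          have "\<bar>F n v\<bar> = \<bar>a n (v + l n)\<bar> / (b n * exp (real n * \<phi> x\<^sub>0))"
            using True bn by (simp add: F_def)
          also have "\<dots> \<le> C1 * \<bar>b n * exp (real n * \<phi> (x\<^sub>0 + ?y) + \<epsilon>1 n (v + l n))\<bar> / (b n * exp (real n * \<phi> x\<^sub>0))"
            using bn by (intro divide_right_mono bound) simp
          also have "\<dots> = C1 * exp (real n * (\<phi> (x\<^sub>0 + ?y) - \<phi> x\<^sub>0) + \<epsilon>1 n (v + l n))"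
            using bn by (simp add: abs_mult exp_add exp_diff right_diff_distrib)
          also have "\<dots> \<le> C1 * exp (- \<kappa>' * real n - \<tau> * q n v)"
            using ex e1(2) by (intro mult_left_mono) auto
          finally show ?thesis by (simp add: exp_diff exp_minus divide_inverse)
        qed (use e1(2) in \<open>simp add: F_def\<close>)
        have "p * exp (- q n v) \<le> p * ?G"
        proof -
          have "m * \<delta>\<^sup>2 \<le> m * (norm ?y)\<^sup>2" using far \<delta> m(1) by (intro mult_left_mono power_mono) auto
          also have "\<dots> \<le> B ?y ?y" by (rule m(2)[OF yv])
          finally have "real n / 4 * (m * \<delta>\<^sup>2) \<le> real n / 4 * B ?y ?y" by (intro mult_left_mono) auto
          moreover have "\<kappa>' * real n \<le> m * \<delta>\<^sup>2 / 4 * real n" by (intro mult_right_mono) (auto simp: \<kappa>'_def)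
          moreover have "real n / 4 * B ?y ?y = q n v / 2" by (simp add: q_def)
          moreover have "\<tau> * q n v \<le> 1 / 2 * q n v" using \<tau>(2) q0 by (intro mult_right_mono)
          ultimately have "- q n v \<le> - \<kappa>' * real n + - (\<tau> * q n v)"
            by (simp add: mult.commute[of "real n" "m * \<delta>\<^sup>2"])
          thus ?thesis unfolding exp_add[symmetric] using p0 by simp
        qed
        moreover have "(C1 + p) * exp (- \<kappa>' * real n) * exp (- (\<tau> * q n v)) = C1 * ?G + p * ?G"
          by (simp add: algebra_simps)
        moreover have "p * exp (- q n v) \<ge> 0" using p0 by simp
        ultimately show ?thesis using F N0 by linarith
      qed
    qed
    thus "\<exists>C \<kappa> \<tau>. \<kappa> > 0 \<and> \<tau> > 0 \<and> (\<forall>\<^sub>F n in sequentially. \<forall>v\<in>zspan xs.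
        \<bar>F n v - p * exp (- (real n * B ((1 / real n) *\<^sub>R v + t n) ((1 / real n) *\<^sub>R v + t n) / 2))\<bar> \<le>
          \<eta> * exp (- ((1 - \<eta>) * (real n * B ((1 / real n) *\<^sub>R v + t n) ((1 / real n) *\<^sub>R v + t n) / 2)))
          + p * (exp (- ((1 - \<eta>) * (real n * B ((1 / real n) *\<^sub>R v + t n) ((1 / real n) *\<^sub>R v + t n) / 2)))
            - exp (- ((1 + \<eta>) * (real n * B ((1 / real n) *\<^sub>R v + t n) ((1 / real n) *\<^sub>R v + t n) / 2))))
          + C * exp (- \<kappa> * real n) * exp (- (\<tau> * (real n * B ((1 / real n) *\<^sub>R v + t n) ((1 / real n) *\<^sub>R v + t n) / 2))))"
      using \<kappa>' \<tau>(1) unfolding q_def y_def by blast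
  qed

  \<comment> \<open>Back from the infinite lattice sum to the finite sum\<close>
  moreover have "infsum (F n) (zspan xs) = (\<Sum>x \<in> lattice_pts L l K n. a n x) / (b n * exp (real n * \<phi> x\<^sub>0))"
    if n: "n > 0" for n
  proof -
    define T where "T = {v \<in> L. x\<^sub>0 + y n v \<in> K}"
    have img: "lattice_pts L l K n = (\<lambda>v. v + l n) ` T"
      using pts[OF n] by (auto simp: T_def lattice_pts_def)
    have "finite T"
    proof (rule ccontr)
      assume inf: "infinite T" \<comment> \<open>the Gaussian is bounded below on \<open>T\<close>, so its lattice sum would diverge\<close>
      have summ: "(\<lambda>v. exp (- (1 * q n v))) summable_on L"
        unfolding q_def y_def L by (rule gaussian_lattice_limit(1)[OF bilB symB xs posB' tV' _ n]) simp_all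
      let ?S = "infsum (\<lambda>v. exp (- (1 * q n v))) L" and ?c = "exp (- (real n * R / 2))"
      obtain N where N: "?S < real N * ?c" using reals_Archimedean3[of ?c] by auto
      obtain X where X: "X \<subseteq> T" "finite X" "card X = N" using infinite_arbitrarily_large[OF inf] by metis
      have "real N * ?c = (\<Sum>v\<in>X. ?c)" using X by simp
      also have "\<dots> \<le> (\<Sum>v\<in>X. exp (- (1 * q n v)))"
      proof (rule sum_mono)
        fix v assume "v \<in> X"
        hence "B (y n v) (y n v) \<le> R" using X by (intro R) (auto simp: T_def)
        thus "?c \<le> exp (- (1 * q n v))" by (simp add: q_def mult_left_mono)
      qed
      also have "\<dots> \<le> ?S" using X by (intro finite_sum_le_infsum[OF summ]) (auto simp: T_def)
      finally show False using N by simp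
    qed
    have "infsum (F n) (zspan xs) = infsum (F n) T"
      unfolding L[symmetric] by (rule infsum_cong_neutral) (auto simp: T_def F_def)
    also have "\<dots> = (\<Sum>v\<in>T. F n v)" using \<open>finite T\<close> by simp
    also have "\<dots> = (\<Sum>v\<in>T. a n (v + l n)) / (b n * exp (real n * \<phi> x\<^sub>0))"
      unfolding sum_divide_distrib by (rule sum.cong) (auto simp: T_def F_def)
    also have "(\<Sum>v\<in>T. a n (v + l n)) = (\<Sum>x \<in> lattice_pts L l K n. a n x)"
      unfolding img by (subst sum.reindex) (auto simp: inj_on_def)
    finally show ?thesis .
  qed
  hence "\<forall>\<^sub>F n in sequentially. infsum (F n) (zspan xs) / real n powr (real (length xs) / 2)
      = (\<Sum>x \<in> lattice_pts L l K n. a n x) / (b n * real n powr (real r / 2) * exp (real n * \<phi> x\<^sub>0))"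
    by (intro eventually_mono[OF eventually_gt_at_top[of 0]]) (simp add: len mult_ac)
  ultimately have "(\<lambda>n. (\<Sum>x \<in> lattice_pts L l K n. a n x) / (b n * real n powr (real r / 2) * exp (real n * \<phi> x\<^sub>0)))
      \<longlonglongrightarrow> p * sqrt ((2 * pi) ^ length xs / gram_det B xs)"
    by (rule Lim_transform_eventually)

  \<comment> \<open>Identification of the constant\<close>
  moreover have "p * sqrt ((2 * pi) ^ length xs / gram_det B xs) =
      (2 * pi) powr (real r / 2) * \<psi> x\<^sub>0 / (lattice_vol L * sqrt (form_det_on B V))"
  proof -
    \<comment> \<open>\<open>xs\<close> is the very choice made inside \<open>lattice_vol\<close>,
      so the squared volume cancels the denominator of \<open>form_det_on\<close>.\<close>
    have "lattice_vol L * sqrt (form_det_on B V) = sqrt (gram_det B xs)"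
      unfolding lattice_vol_def xs_def[symmetric] fdet real_sqrt_mult[symmetric] using gin by simp
    moreover have "(2 * pi) powr (real r / 2) = sqrt ((2 * pi) ^ r)"
      by (rule powr_half_of_nat) simp
    ultimately show ?thesis by (simp add: p_def len real_sqrt_divide)
  qed
  \<comment> \<open>A nonzero limit is what turns convergence of the quotient into asymptotic
    equivalence.\<close>
  moreover have "p * sqrt ((2 * pi) ^ length xs / gram_det B xs) \<noteq> 0"
    using gB assms(16) by (simp add: p_def)
  ultimately have "(\<lambda>n. \<Sum>x \<in> lattice_pts L l K n. a n x) \<sim>[sequentially]
     (\<lambda>n. (2 * pi) powr (real r / 2) * \<psi> x\<^sub>0 / (lattice_vol L * sqrt (form_det_on B V))
        * (b n * real n powr (real r / 2) * exp (real n * \<phi> x\<^sub>0)))"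
    by (intro asymp_equivI'_const) auto
  thus ?thesis by (simp add: B_def mult.assoc)
qed

end
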